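(* Let $p\ge 3$ be an integer. For the reciprocal class in $\Gamma_p$ of any reciprocal hyperbolic element of $\Gamma_p$, the following holds. (1) If $p$ is odd, every reciprocal class has exactly four symmetric elements. (2) Let $p=2m$ be even. (a) Suppose that in the reciprocal class the reciprocators are conjugate to $\iota$. Then there are exactly four symmetric elements in that class. (b) Suppose that in the reciprocal class the reciprocators are conjugate to $\gamma_p^m$. Then there are exactly $2p$ $p$-reciprocal elements in that class. (c) Suppose that in the reciprocal class each reciprocal element has two types of reciprocators, one type conjugate to $\iota$ and the other type conjugate to $\gamma_p^m$. (i) If the reciprocal class does not contain any non-zero power of $\iota\gamma_p^m$, then the class has exactly two symmetric elements and $p$ $p$-reciprocal elements. (ii) If the reciprocal class contains some non-zero power of $\iota\gamma_p^m$, then the class has exactly two symmetric $p$-reciprocal elements and exactly $p-2$ further $p$-reciprocal elements that are not symmetric $p$-reciprocal.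
   Context: For an integer $p\ge 3$ the Hecke group $\Gamma_p\subset \mathrm{PSL}(2,\mathbb{R})$ is generated by $\iota: z\mapsto -1/z$ and $\alpha_p: z\mapsto z+2\cos(\pi/p)$. Put $\gamma_p=\iota\alpha_p: z\mapsto -1/(z+2\cos(\pi/p))$, which has order $p$; for $p=2m$ even, $\gamma_p^m$ is an involution. An element $g$ of $\Gamma_p$ is reciprocal if there is $h\in\Gamma_p$ with $g^{-1}=hgh^{-1}$; such an $h$ is called a reciprocator of $g$. A reciprocal class is the $\Gamma_p$-conjugacy class of a reciprocal element; here only classes of hyperbolic elements (lifts have $|\mathrm{trace}|>2$) are considered. Conjugacy is in $\Gamma_p$, and elements are counted in $\Gamma_p\subset\mathrm{PSL}(2,\mathbb{R})$. An element of $\mathrm{PSL}(2,\mathbb{R})$ is symmetric if it is represented by a symmetric matrix in $\mathrm{SL}(2,\mathbb{R})$. Fixed-point ratio: for a hyperbolic $A\in \mathrm{PSL}(2,\mathbb{R})$ represented by $\begin{bmatrix} a& b\\ c& d\end{bmatrix}$, $\theta_A=\frac{b-c}{a-d}$ if $a\ne d$; $\theta_A=\infty$ if $a=d$, $b\neq c$; $\theta_A=1$ if $a=d$, $b=c$. A reciprocal (hyperbolic) element $M\in\Gamma_p$ ($p=2m$) is $p$-reciprocal if $\theta_M$ is either $\cos(\pi/p)$ or $1$; equivalently, $\gamma_p^m$ is a reciprocator of $M$. It is symmetric $p$-reciprocal if $\theta_M=1$; equivalently, both $\gamma_p^m$ and $\iota$ are reciprocators of $M$. *)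

theory Defs
  imports "HOL-Analysis.Analysis" "HOL-Algebra.Algebra"
begin

section \<open>The group PSL(2,R)\<close>

definition SL2 :: "(real^2^2) monoid" where
  "SL2 = \<lparr>carrier = {A. det A = 1}, mult = (**), one = mat 1\<rparr>"

definition PSL2 :: "(real^2^2) set monoid" where
  "PSL2 = SL2 Mod {mat 1, - mat 1}"

definition psl :: "real^2^2 \<Rightarrow> (real^2^2) set" where
  "psl A = {A, - A}"

abbreviation mat22 :: "real \<Rightarrow> real \<Rightarrow> real \<Rightarrow> real \<Rightarrow> real^2^2" where
  "mat22 a b c d \<equiv> vector [vector [a, b], vector [c, d]]"

lemma mat22_cong: "(A = B) = (A$1$1 = B$1$1 \<and> A$1$2 = B$1$2 \<and> A$2$1 = B$2$1 \<and> A$2$2 = B$2$2)"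
  for A B :: "real^2^2"
  by (simp add: vec_eq_iff forall_2)

lemma SL2_simps:
  "carrier SL2 = {A. det A = 1}" "mult SL2 = (**)" "one SL2 = mat 1"
  by (simp_all add: SL2_def)

lemma group_SL2: "group SL2"
proof (rule groupI)
  fix A assume "A \<in> carrier SL2"
  then have d: "det A = 1" by (simp add: SL2_def)
  let ?B = "mat22 (A$2$2) (- A$1$2) (- A$2$1) (A$1$1)"
  have "?B ** A = mat 1"
    using d by (simp add: mat22_cong matrix_matrix_mult_def det_2 mat_def sum_2 algebra_simps)
  moreover have "det ?B = 1" using d by (simp add: det_2 algebra_simps)
  ultimately show "\<exists>B\<in>carrier SL2. B \<otimes>\<^bsub>SL2\<^esub> A = \<one>\<^bsub>SL2\<^esub>"
    by (auto simp: SL2_def)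
qed (auto simp: SL2_def det_mul matrix_mul_assoc)

lemma neg_mult: "(- A) ** B = - (A ** B)" "A ** (- B) = - (A ** B)" for A B :: "real^2^2"
  by (simp_all add: mat22_cong matrix_matrix_mult_def sum_2)

lemma det_neg2: "det (- A) = det A" for A :: "real^2^2"
  by (simp add: det_2)

lemma psl_eq_coset: "psl A = {mat 1, - mat 1} #>\<^bsub>SL2\<^esub> A"
  by (auto simp: psl_def r_coset_def SL2_def neg_mult)

lemma normal_SL2: "{mat 1, - mat 1} \<lhd> SL2"
proof -
  interpret group SL2 by (rule group_SL2)
  have "inv\<^bsub>SL2\<^esub> (- mat 1) = - mat 1"
    by (rule inv_equality) (auto simp: SL2_simps neg_mult det_neg2)
  moreover have "inv\<^bsub>SL2\<^esub> (mat 1) = mat 1"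
    by (rule inv_equality) (auto simp: SL2_simps)
  ultimately have "subgroup {mat 1, - mat 1} SL2"
    by (auto intro!: subgroupI simp: SL2_simps neg_mult det_neg2)
  then show ?thesis
    by (rule normalI) (auto simp: r_coset_def l_coset_def SL2_simps neg_mult)
qed

lemma group_PSL2: "group PSL2"
  unfolding PSL2_def by (rule normal.factorgroup_is_group[OF normal_SL2])

lemma carrier_PSL2: "carrier PSL2 = psl ` {A. det A = 1}"
  by (auto simp: PSL2_def FactGroup_def RCOSETS_def psl_eq_coset SL2_def)

lemma mult_PSL2: "psl A \<otimes>\<^bsub>PSL2\<^esub> psl B = psl (A ** B)"
  by (auto simp: PSL2_def FactGroup_def set_mult_def psl_def SL2_def neg_mult)

definition hyperbolic :: "(real^2^2) set \<Rightarrow> bool" where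
  "hyperbolic g \<longleftrightarrow> (\<forall>A\<in>g. \<bar>trace A\<bar> > 2)"

definition symmetric :: "(real^2^2) set \<Rightarrow> bool" where
  "symmetric g \<longleftrightarrow> (\<exists>A\<in>g. transpose A = A)"

definition matrix_fixed_point_ratio :: "real^2^2 \<Rightarrow> ereal" where
  "matrix_fixed_point_ratio A =
     (if A$1$1 \<noteq> A$2$2 then ereal ((A$1$2 - A$2$1) / (A$1$1 - A$2$2))
      else if A$1$2 \<noteq> A$2$1 then \<infinity> else 1)"

text \<open>The two representatives of an element of PSL(2,R) have the same ratio
  (see \<open>fixed_point_ratio_psl\<close> below), so the description is unique.\<close>

definition fixed_point_ratio :: "(real^2^2) set \<Rightarrow> ereal" where
  "fixed_point_ratio g = (THE t. \<forall>A\<in>g. matrix_fixed_point_ratio A = t)"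

lemma matrix_fixed_point_ratio_neg:
  "matrix_fixed_point_ratio (- A) = matrix_fixed_point_ratio A"
proof -
  have "(c - b) / (d - a) = (b - c) / (a - d)" for a b c d :: real
    by (metis minus_diff_eq minus_divide_divide)
  then show ?thesis
    by (simp add: matrix_fixed_point_ratio_def)
qed

lemma fixed_point_ratio_psl: "fixed_point_ratio (psl A) = matrix_fixed_point_ratio A"
  unfolding fixed_point_ratio_def psl_def
  by (rule the_equality) (auto simp: matrix_fixed_point_ratio_neg)

section \<open>Reciprocal elements of a group\<close>

definition conjugate :: "('a, 'b) monoid_scheme \<Rightarrow> 'a \<Rightarrow> 'a \<Rightarrow> bool" where
  "conjugate G x y \<longleftrightarrow> (\<exists>h\<in>carrier G. y = h \<otimes>\<^bsub>G\<^esub> x \<otimes>\<^bsub>G\<^esub> inv\<^bsub>G\<^esub> h)"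

definition conjugacy_class :: "('a, 'b) monoid_scheme \<Rightarrow> 'a \<Rightarrow> 'a set" where
  "conjugacy_class G x = {y. conjugate G x y}"

definition reciprocators :: "('a, 'b) monoid_scheme \<Rightarrow> 'a \<Rightarrow> 'a set" where
  "reciprocators G g = {h \<in> carrier G. inv\<^bsub>G\<^esub> g = h \<otimes>\<^bsub>G\<^esub> g \<otimes>\<^bsub>G\<^esub> inv\<^bsub>G\<^esub> h}"

definition reciprocal :: "('a, 'b) monoid_scheme \<Rightarrow> 'a \<Rightarrow> bool" where
  "reciprocal G g \<longleftrightarrow> g \<in> carrier G \<and> reciprocators G g \<noteq> {}"

section \<open>Hecke groups\<close>

definition iota :: "(real^2^2) set" where
  "iota = psl (mat22 0 (-1) 1 0)"

definition alpha :: "nat \<Rightarrow> (real^2^2) set" where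
  "alpha p = psl (mat22 1 (2 * cos (pi / real p)) 0 1)"

definition gam :: "nat \<Rightarrow> (real^2^2) set" where
  "gam p = iota \<otimes>\<^bsub>PSL2\<^esub> alpha p"

definition Hecke :: "nat \<Rightarrow> (real^2^2) set monoid" where
  "Hecke p = subgroup_generated PSL2 {iota, alpha p}"

text \<open>Only conjugacy classes of hyperbolic elements count as reciprocal classes.\<close>

definition reciprocal_class :: "nat \<Rightarrow> (real^2^2) set set \<Rightarrow> bool" where
  "reciprocal_class p C \<longleftrightarrow>
     (\<exists>g. hyperbolic g \<and> reciprocal (Hecke p) g \<and> C = conjugacy_class (Hecke p) g)"

text \<open>The next two notions are meant for even \<open>p\<close>.\<close>

definition p_reciprocal :: "nat \<Rightarrow> (real^2^2) set \<Rightarrow> bool" where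
  "p_reciprocal p M \<longleftrightarrow> hyperbolic M \<and> reciprocal (Hecke p) M \<and>
     (fixed_point_ratio M = ereal (cos (pi / real p)) \<or> fixed_point_ratio M = 1)"

definition symmetric_p_reciprocal :: "nat \<Rightarrow> (real^2^2) set \<Rightarrow> bool" where
  "symmetric_p_reciprocal p M \<longleftrightarrow> hyperbolic M \<and> reciprocal (Hecke p) M \<and>
     fixed_point_ratio M = 1"

lemma gam_eq: "gam p = psl (mat22 0 (-1) 1 (2 * cos (pi / real p)))"
proof -
  have "mat22 0 (-1) 1 0 ** mat22 1 (2 * cos (pi / real p)) 0 1
      = mat22 0 (-1) 1 (2 * cos (pi / real p))"
    by (simp add: mat22_cong matrix_matrix_mult_def sum_2)
  then show ?thesis
    by (simp add: gam_def iota_def alpha_def mult_PSL2)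
qed

lemma generators_in_PSL2: "iota \<in> carrier PSL2" "alpha p \<in> carrier PSL2"
  unfolding carrier_PSL2 iota_def alpha_def by (auto intro!: imageI simp: det_2)

lemma group_Hecke: "group (Hecke p)"
  unfolding Hecke_def by (rule group.group_subgroup_generated[OF group_PSL2])

lemma carrier_Hecke: "carrier (Hecke p) = generate PSL2 {iota, alpha p}"
  using generators_in_PSL2 by (simp add: Hecke_def carrier_subgroup_generated)

end

theory Submission
  imports Defs
begin

text \<open>
  A hyperbolic \<open>g\<close> in the Hecke group is symmetric if and only if \<open>iota\<close> is a reciprocator of \<open>g\<close>, and for
  \<open>p = 2 m\<close> it is p-reciprocal if and only if \<open>gam^m\<close> is one. Both are instances of
  \<open>reciprocators_psl_iff\<close>: an element \<open>R\<close> reciprocates a hyperbolic \<open>A\<close> exactly if \<open>R\<close> and \<open>R A\<close> have trace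
  0. All cases of the theorem therefore ask how many members of the class of \<open>g\<close> have a given
  involution \<open>t\<close> as a reciprocator.

  The centralizer \<open>Z\<close> of \<open>g\<close> is infinite cyclic, and the reciprocators of \<open>g\<close> form a coset \<open>r Z\<close> on which \<open>Z\<close>
  acts by conjugation through multiplication by squares. So there are two classes of reciprocators
  under \<open>Z\<close>, those of \<open>r\<close> and of \<open>r e\<close> for a generator \<open>e\<close> of \<open>Z\<close>. Each of them that is conjugate to \<open>t\<close> in the
  whole group accounts for as many members of the class as the centralizer of \<open>t\<close> has elements
  (\<open>card_class_with_reciprocator\<close>). Reciprocators are involutions, and every involution is conjugate to
  \<open>iota\<close>, with a centralizer of order 2, or to \<open>gam^m\<close>, with a centralizer of order \<open>p\<close>. This gives 4 and
  \<open>2 p\<close> when both classes of reciprocators have the same type, and 2 and \<open>p\<close> when the types differ.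

  The facts on the Hecke group come from one observation. Up to sign the matrix of \<open>iota gam^k\<close> with
  \<open>0 < k < p\<close> has nonnegative entries, the diagonal ones at least 1, and some off-diagonal entry is at
  least 1. Hence the entries of a product of \<open>n\<close> such letters have a sum of at least \<open>n + 2\<close>
  (\<open>word_large\<close>). As every element is a rotation times a word of letters times an optional \<open>iota\<close>, this
  yields discreteness (\<open>finite_entry_bounded\<close>), which makes \<open>Z\<close> cyclic; it shows that a cyclically
  reduced nonempty word is no involution, since its trace is at least 2; and it determines the
  centralizers of the two involutions.

  Two points need care in the even case. A fixed point ratio of 1 with different diagonal entries
  would also count as p-reciprocal by definition; it would mean that the element fixes -1 but not 1,
  and conjugating by powers of \<open>iota gam^m\<close>, whose axis joins -1 and 1, would contradict discreteness
  (\<open>fixing_minus_one\<close>). And if the class contains a power of \<open>iota gam^m\<close>, its members with fixed points -1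
  and 1 are determined by the trace up to inversion, which gives exactly two symmetric p-reciprocal
  elements (\<open>card_symmetric_p_reciprocal\<close>).
\<close>

section \<open>Two-by-two matrices and elements of PSL(2,R)\<close>

text \<open>For determinant 1 this is the inverse; unlike matrix inversion it is linear in the entries, so that all
  identities below are polynomial.\<close>

definition adj :: "real^2^2 \<Rightarrow> real^2^2" where
  "adj A = mat22 (A$2$2) (- A$1$2) (- A$2$1) (A$1$1)"

lemma mat22_cases: obtains a b c d where "A = mat22 a b c d"
  by (rule that[of "A$1$1" "A$1$2" "A$2$1" "A$2$2"]) (simp add: mat22_cong)

lemma mat22_eq_iff [simp]:
  "mat22 a b c d = mat22 a' b' c' d' \<longleftrightarrow> a = a' \<and> b = b' \<and> c = c' \<and> d = d'"
  by (simp add: mat22_cong)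

lemma mat22_mult [simp]:
  "mat22 a b c d ** mat22 a' b' c' d' =
    mat22 (a * a' + b * c') (a * b' + b * d') (c * a' + d * c') (c * b' + d * d')"
  by (simp add: mat22_cong matrix_matrix_mult_def sum_2)

lemma mat22_uminus [simp]: "- mat22 a b c d = mat22 (-a) (-b) (-c) (-d)"
  by (simp add: mat22_cong)

lemma mat22_one: "mat 1 = mat22 1 0 0 1"
  by (simp add: mat22_cong mat_def)

lemma mat22_det [simp]: "det (mat22 a b c d) = a * d - b * c"
  by (simp add: det_2)

lemma mat22_trace [simp]: "trace (mat22 a b c d) = a + d"
  by (simp add: trace_def sum_2)

lemma trace_uminus [simp]: "trace (- A) = - trace A" for A :: "real^2^2"
  by (simp add: trace_def sum_2)

lemma adj_mat22 [simp]: "adj (mat22 a b c d) = mat22 d (-b) (-c) a"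
  by (simp add: adj_def)

lemma adj_mult: "det A = 1 \<Longrightarrow> adj A ** A = mat 1" "det A = 1 \<Longrightarrow> A ** adj A = mat 1"
  by (cases A rule: mat22_cases, simp add: mat22_one algebra_simps)+

lemma adj_adj [simp]: "adj (adj A) = A"
  by (cases A rule: mat22_cases) simp

lemma trace_conj:
  assumes "det R = 1"
  shows "trace (R ** A ** adj R) = trace A"
proof -
  obtain a b c d x y z w where eq: "A = mat22 a b c d" "R = mat22 x y z w"
    by (metis mat22_cases)
  have "trace (R ** A ** adj R) = (a + d) * (x * w - y * z)"
    unfolding eq by (simp add: algebra_simps)
  then show ?thesis using assms eq by simp
qed

lemma det_adj [simp]: "det (adj A) = det A"
  by (cases A rule: mat22_cases) simp

text \<open>A scalar matrix of determinant 1 is the identity up to sign, of trace 2 in absolute value.\<close>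

lemma hyperbolic_nonscalar:
  assumes "\<bar>trace (mat22 a b c d)\<bar> > 2" "det (mat22 a b c d) = 1"
  shows "\<not> (b = 0 \<and> c = 0 \<and> a = d)"
proof
  assume "b = 0 \<and> c = 0 \<and> a = d"
  then have "a\<^sup>2 = 1" "\<bar>2 * a\<bar> > 2" using assms by (auto simp: power2_eq_square)
  then show False by (auto simp: power2_eq_1_iff)
qed

lemma psl_eq_iff: "psl A = psl B \<longleftrightarrow> A = B \<or> A = - B"
  by (auto simp: psl_def doubleton_eq_iff)

lemma psl_uminus [simp]: "psl (- A) = psl A"
  by (simp add: psl_eq_iff)

lemma psl_mult_neg: "psl (A ** (- B)) = psl (A ** B)" "psl ((- A) ** B) = psl (A ** B)" for A B :: "real^2^2"
  by (simp_all add: neg_mult)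

text \<open>Signs are irrelevant in PSL(2,R): products may be computed with any choice of representatives.\<close>

lemma psl_mult_cong:
  assumes "psl A = psl A'" "psl B = psl B'"
  shows "psl (A ** B) = psl (A' ** B')"
  using assms by (auto simp: psl_eq_iff neg_mult)

lemma psl_trace_zero: "psl A = psl B \<Longrightarrow> trace A = 0 \<longleftrightarrow> trace B = 0"
  by (auto simp: psl_eq_iff)

lemma hyperbolic_psl [simp]: "hyperbolic (psl A) \<longleftrightarrow> \<bar>trace A\<bar> > 2"
  by (auto simp: hyperbolic_def psl_def)

lemma Hecke_mult [simp]: "psl A \<otimes>\<^bsub>Hecke p\<^esub> psl B = psl (A ** B)"
  by (simp add: Hecke_def mult_PSL2)

lemma Hecke_one: "\<one>\<^bsub>Hecke p\<^esub> = psl (mat 1)"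
  by (auto simp: Hecke_def PSL2_def FactGroup_def psl_def)

lemma carrier_Hecke_psl:
  assumes "x \<in> carrier (Hecke p)"
  obtains A where "x = psl A" "det A = 1"
proof -
  have "carrier (Hecke p) \<subseteq> carrier PSL2"
    unfolding Hecke_def by (rule group.carrier_subgroup_generated_subset[OF group_PSL2])
  then show ?thesis using assms that by (auto simp: carrier_PSL2)
qed

lemma Hecke_inv:
  assumes "psl A \<in> carrier (Hecke p)" "det A = 1"
  shows "inv\<^bsub>Hecke p\<^esub> psl A = psl (adj A)"
proof -
  interpret H: group "Hecke p" by (rule group_Hecke)
  obtain B where B: "inv\<^bsub>Hecke p\<^esub> psl A = psl B" "det B = 1"
    using carrier_Hecke_psl[OF H.inv_closed[OF assms(1)]] by blast
  have "psl (B ** A) = psl (mat 1)"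
    using H.l_inv[OF assms(1)] B by (simp add: Hecke_one)
  then have "B ** A ** adj A = adj A \<or> B ** A ** adj A = - adj A"
    by (auto simp: psl_eq_iff neg_mult)
  then have "B = adj A \<or> B = - adj A"
    by (simp add: matrix_mul_assoc[symmetric] adj_mult(2)[OF assms(2)])
  then have "psl B = psl (adj A)" by (simp add: psl_eq_iff)
  then show ?thesis using B(1) by (rule trans[rotated])
qed

section \<open>Conjugacy counts in an abstract group\<close>

definition centralizer :: "('a, 'b) monoid_scheme \<Rightarrow> 'a \<Rightarrow> 'a set" where
  "centralizer G x = {c \<in> carrier G. c \<otimes>\<^bsub>G\<^esub> x = x \<otimes>\<^bsub>G\<^esub> c}"

context group
begin

lemma inv_mult_cancel:
  assumes "x \<in> carrier G" "y \<in> carrier G"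
  shows "inv x \<otimes> (x \<otimes> y) = y" "x \<otimes> (inv x \<otimes> y) = y"
  using assms by (simp_all add: m_assoc[symmetric])

lemma centralizer_closed:
  assumes "g \<in> carrier G"
  shows "x \<in> centralizer G g \<Longrightarrow> y \<in> centralizer G g \<Longrightarrow> x \<otimes> y \<in> centralizer G g"
    and "x \<in> centralizer G g \<Longrightarrow> inv x \<in> centralizer G g"
    and "\<one> \<in> centralizer G g"
proof -
  show "x \<otimes> y \<in> centralizer G g" if "x \<in> centralizer G g" "y \<in> centralizer G g"
  proof -
    have xy: "x \<in> carrier G" "y \<in> carrier G" "x \<otimes> g = g \<otimes> x" "y \<otimes> g = g \<otimes> y"
      using that by (auto simp: centralizer_def)
    then have "x \<otimes> y \<otimes> g = x \<otimes> (y \<otimes> g)" using assms by (simp add: m_assoc)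
    also have "\<dots> = x \<otimes> g \<otimes> y" using xy(1,2) assms by (simp add: xy(4) m_assoc)
    also have "\<dots> = g \<otimes> (x \<otimes> y)" using xy(1,2) assms by (simp add: xy(3) m_assoc)
    finally show ?thesis using xy assms by (simp add: centralizer_def)
  qed
  show "inv x \<in> centralizer G g" if "x \<in> centralizer G g"
  proof -
    have x: "x \<in> carrier G" "x \<otimes> g = g \<otimes> x" using that by (auto simp: centralizer_def)
    have "inv x \<otimes> g = inv x \<otimes> (g \<otimes> x) \<otimes> inv x" using x(1) assms by (simp add: m_assoc)
    also have "\<dots> = g \<otimes> inv x"
      using x(1) assms by (simp add: x(2)[symmetric] m_assoc inv_mult_cancel)
    finally show ?thesis using x by (simp add: centralizer_def)
  qed
  show "\<one> \<in> centralizer G g" using assms by (simp add: centralizer_def)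
qed

lemma conj_cancel:
  assumes "h \<in> carrier G" "x \<in> carrier G" "y \<in> carrier G"
  shows "h \<otimes> x \<otimes> inv h = y \<longleftrightarrow> h \<otimes> x = y \<otimes> h"
  using assms by (metis inv_closed inv_solve_right m_closed)

lemma conj_mult:
  assumes "h \<in> carrier G" "k \<in> carrier G" "x \<in> carrier G"
  shows "h \<otimes> (k \<otimes> x \<otimes> inv k) \<otimes> inv h = (h \<otimes> k) \<otimes> x \<otimes> inv (h \<otimes> k)"
  using assms by (simp add: m_assoc inv_mult_group)

lemma conjugate_sym:
  assumes "conjugate G x y" "x \<in> carrier G"
  shows "conjugate G y x"
proof -
  obtain h where h: "h \<in> carrier G" "y = h \<otimes> x \<otimes> inv h" using assms by (auto simp: conjugate_def)
  then have "x = inv h \<otimes> y \<otimes> inv (inv h)" using assms by (simp add: m_assoc inv_mult_cancel)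
  then show ?thesis using h(1) unfolding conjugate_def by (intro bexI[of _ "inv h"]) auto
qed

lemma conjugate_trans:
  assumes "conjugate G x y" "conjugate G y z" "x \<in> carrier G"
  shows "conjugate G x z"
  using assms conj_mult unfolding conjugate_def by (metis m_closed)

lemma conj_eq_iff_centralizer:
  assumes "h \<in> carrier G" "k \<in> carrier G" "x \<in> carrier G"
  shows "h \<otimes> x \<otimes> inv h = k \<otimes> x \<otimes> inv k \<longleftrightarrow> inv k \<otimes> h \<in> centralizer G x"
proof -
  have "h \<otimes> x \<otimes> inv h = k \<otimes> x \<otimes> inv k \<longleftrightarrow> h \<otimes> x = k \<otimes> x \<otimes> inv k \<otimes> h"
    using assms by (intro conj_cancel) auto
  also have "\<dots> \<longleftrightarrow> inv k \<otimes> (h \<otimes> x) = inv k \<otimes> (k \<otimes> x \<otimes> inv k \<otimes> h)"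
    using assms by (metis inv_closed inv_mult_cancel(2) m_closed)
  also have "\<dots> \<longleftrightarrow> inv k \<otimes> h \<in> centralizer G x"
    using assms by (simp add: centralizer_def m_assoc inv_mult_cancel)
  finally show ?thesis .
qed

lemma reciprocators_conj:
  assumes "h \<in> carrier G" "g \<in> carrier G" "k \<in> carrier G"
  shows "h \<otimes> k \<otimes> inv h \<in> reciprocators G (h \<otimes> g \<otimes> inv h) \<longleftrightarrow> k \<in> reciprocators G g"
proof -
  have "inv (h \<otimes> g \<otimes> inv h) = h \<otimes> inv g \<otimes> inv h"
    using assms by (simp add: inv_mult_group m_assoc)
  moreover have "(h \<otimes> k \<otimes> inv h) \<otimes> (h \<otimes> g \<otimes> inv h) \<otimes> inv (h \<otimes> k \<otimes> inv h)
      = h \<otimes> (k \<otimes> g \<otimes> inv k) \<otimes> inv h"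
    using assms by (simp add: inv_mult_group m_assoc inv_mult_cancel)
  moreover have "h \<otimes> x \<otimes> inv h = h \<otimes> y \<otimes> inv h \<longleftrightarrow> x = y"
    if "x \<in> carrier G" "y \<in> carrier G" for x y
    using assms that by simp
  ultimately show ?thesis using assms by (simp add: reciprocators_def)
qed

text \<open>Conjugation transports centralizers; together with the next lemma this makes the order of the
  centralizer an invariant that separates \<open>iota\<close> from the involution in the cyclic factor.\<close>

lemma centralizer_conj:
  assumes "h \<in> carrier G" "x \<in> carrier G" "c \<in> centralizer G x"
  shows "h \<otimes> c \<otimes> inv h \<in> centralizer G (h \<otimes> x \<otimes> inv h)"
proof -
  have c: "c \<in> carrier G" "c \<otimes> x = x \<otimes> c" using assms by (auto simp: centralizer_def)
  have "(h \<otimes> c \<otimes> inv h) \<otimes> (h \<otimes> x \<otimes> inv h) = h \<otimes> (c \<otimes> x) \<otimes> inv h"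
    using c(1) assms by (simp add: m_assoc inv_mult_cancel)
  also have "\<dots> = (h \<otimes> x \<otimes> inv h) \<otimes> (h \<otimes> c \<otimes> inv h)"
    unfolding c(2) using c(1) assms by (simp add: m_assoc inv_mult_cancel)
  finally show ?thesis using c assms by (simp add: centralizer_def)
qed

lemma card_centralizer_conjugate:
  assumes "conjugate G x y" "x \<in> carrier G"
  shows "card (centralizer G x) = card (centralizer G y)"
proof -
  obtain h where h: "h \<in> carrier G" "y = h \<otimes> x \<otimes> inv h" using assms by (auto simp: conjugate_def)
  have x: "x = inv h \<otimes> y \<otimes> inv (inv h)" and y: "y \<in> carrier G"
    using h assms by (simp_all add: m_assoc inv_mult_cancel)
  have "bij_betw (\<lambda>c. h \<otimes> c \<otimes> inv h) (centralizer G x) (centralizer G y)"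
  proof (rule bij_betw_byWitness[where f' = "\<lambda>c. inv h \<otimes> c \<otimes> inv (inv h)"])
    show "(\<lambda>c. h \<otimes> c \<otimes> inv h) ` centralizer G x \<subseteq> centralizer G y"
      using centralizer_conj[OF h(1) assms(2)] h(2) by auto
    show "(\<lambda>c. inv h \<otimes> c \<otimes> inv (inv h)) ` centralizer G y \<subseteq> centralizer G x"
      using centralizer_conj[OF _ y, of "inv h"] h(1) x by auto
  qed (use h assms in \<open>auto simp: centralizer_def m_assoc inv_mult_cancel\<close>)
  then show ?thesis by (rule bij_betw_same_card)
qed

text \<open>The reciprocators of \<open>g\<close> form the coset \<open>r Z\<close> of the centralizer \<open>Z\<close> of \<open>g\<close>. As \<open>r\<close> inverts \<open>Z\<close>,
  conjugating \<open>r\<close> by \<open>y\<close> in \<open>Z\<close> multiplies it by a square: \<open>inv y r y = r y y\<close>. Hence the cosets of the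
  squares in \<open>Z\<close>, represented by \<open>1\<close> and \<open>e\<close>, correspond to the \<open>Z\<close>-classes of reciprocators.\<close>

lemma reciprocator_conj_cases:
  assumes g: "g \<in> carrier G" and r: "r \<in> reciprocators G g"
    and inverts: "\<And>z. z \<in> centralizer G g \<Longrightarrow> r \<otimes> z = inv z \<otimes> r"
    and comm: "\<And>y z. y \<in> centralizer G g \<Longrightarrow> z \<in> centralizer G g \<Longrightarrow> y \<otimes> z = z \<otimes> y"
    and e: "e \<in> centralizer G g"
    and squares: "\<And>z. z \<in> centralizer G g \<Longrightarrow>
      \<exists>y\<in>centralizer G g. z = y \<otimes> y \<or> z = y \<otimes> y \<otimes> e"
    and q: "q \<in> reciprocators G g"
  obtains y s where "y \<in> centralizer G g" "s \<in> {r, r \<otimes> e}" "q = inv y \<otimes> s \<otimes> y"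
proof -
  let ?Z = "centralizer G g"
  have Zc: "z \<in> carrier G" if "z \<in> ?Z" for z using that by (simp add: centralizer_def)
  have rc: "r \<in> carrier G" "q \<in> carrier G" and "r \<otimes> g \<otimes> inv r = q \<otimes> g \<otimes> inv q"
    using r q by (auto simp: reciprocators_def)
  then have "inv r \<otimes> q \<in> ?Z" using conj_eq_iff_centralizer[of q r g] g by simp
  then obtain y where y: "y \<in> ?Z" "inv r \<otimes> q = y \<otimes> y \<or> inv r \<otimes> q = y \<otimes> y \<otimes> e"
    using squares by blast
  have qr: "q = r \<otimes> (inv r \<otimes> q)" using rc by (simp add: inv_mult_cancel)
  have ry: "r \<otimes> y = inv y \<otimes> r" using inverts y by blast
  note [simp] = Zc[OF y(1)] Zc[OF e] rc
  have "r \<otimes> (y \<otimes> y) = inv y \<otimes> r \<otimes> y" using ry by (simp add: m_assoc[symmetric])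
  moreover have "r \<otimes> (y \<otimes> y \<otimes> e) = inv y \<otimes> (r \<otimes> e) \<otimes> y"
  proof -
    have "r \<otimes> (y \<otimes> y \<otimes> e) = r \<otimes> y \<otimes> (y \<otimes> e)" by (simp add: m_assoc)
    also have "\<dots> = inv y \<otimes> r \<otimes> (e \<otimes> y)" using ry comm[OF y(1) e] by simp
    finally show ?thesis by (simp add: m_assoc)
  qed
  ultimately have "q = inv y \<otimes> r \<otimes> y \<or> q = inv y \<otimes> (r \<otimes> e) \<otimes> y"
    using qr y(2) by metis
  then show ?thesis using that y(1) by blast
qed

text \<open>An element \<open>h g inv h\<close> of the class has \<open>t\<close> as a reciprocator exactly if \<open>inv h t h\<close> is a reciprocator
  of \<open>g\<close>. Replacing \<open>h\<close> by \<open>h y\<close> with \<open>y\<close> in the centralizer \<open>Z\<close> of \<open>g\<close> does not change the element and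
  moves that reciprocator to one of the two representatives \<open>r\<close> and \<open>r e\<close>. For a representative
  conjugate to \<open>t\<close>, the conjugating \<open>h\<close> form a coset of the centralizer of \<open>t\<close>, and distinct choices give
  distinct elements because \<open>Z\<close> is torsion free and \<open>e\<close> is not a square. So each representative
  conjugate to \<open>t\<close> contributes as many elements as the centralizer of \<open>t\<close> has.\<close>

lemma card_class_with_reciprocator:
  assumes g: "g \<in> carrier G" and r: "r \<in> reciprocators G g" and t: "t \<in> carrier G"
    and inverts: "\<And>z. z \<in> centralizer G g \<Longrightarrow> r \<otimes> z = inv z \<otimes> r"
    and comm: "\<And>y z. y \<in> centralizer G g \<Longrightarrow> z \<in> centralizer G g \<Longrightarrow> y \<otimes> z = z \<otimes> y"
    and e: "e \<in> centralizer G g"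
    and squares: "\<And>z. z \<in> centralizer G g \<Longrightarrow>
      \<exists>y\<in>centralizer G g. z = y \<otimes> y \<or> z = y \<otimes> y \<otimes> e"
    and e_nonsquare: "\<And>y. y \<in> centralizer G g \<Longrightarrow> y \<otimes> y \<noteq> e"
    and torsion_free: "\<And>y. y \<in> centralizer G g \<Longrightarrow> y \<otimes> y = \<one> \<Longrightarrow> y = \<one>"
  shows "card {x \<in> conjugacy_class G g. t \<in> reciprocators G x}
    = card (centralizer G t) * card {s \<in> {r, r \<otimes> e}. conjugate G s t}"
proof -
  let ?Z = "centralizer G g"
  have Zc: "z \<in> carrier G" if "z \<in> ?Z" for z using that by (simp add: centralizer_def)
  have gZ: "g \<in> ?Z" using g by (simp add: centralizer_def)
  note Z = centralizer_closed[OF g]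
  have rc: "r \<in> carrier G" and rg: "inv g = r \<otimes> g \<otimes> inv r" using r by (auto simp: reciprocators_def)
  note [simp] = rc g t Zc Z e
  define T where "T = {s \<in> {r, r \<otimes> e}. conjugate G s t}"
  have "\<forall>s\<in>T. \<exists>h\<in>carrier G. t = h \<otimes> s \<otimes> inv h" by (auto simp: T_def conjugate_def)
  then obtain k where k: "\<And>s. s \<in> T \<Longrightarrow> k s \<in> carrier G"
      "\<And>s. s \<in> T \<Longrightarrow> k s \<otimes> s \<otimes> inv (k s) = t" by metis
  have Tc: "s \<in> carrier G" if "s \<in> T" for s using that by (auto simp: T_def)
  \<comment> \<open>Like \<open>r\<close>, the other representative inverts the centralizer.\<close>
  have T_inverts: "s \<otimes> z = inv z \<otimes> s" if "s \<in> T" "z \<in> ?Z" for s z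
  proof -
    have "r \<otimes> e \<otimes> z = inv z \<otimes> (r \<otimes> e)"
      using that(2) comm[OF e that(2)] inverts[OF that(2)]
      by (metis Zc e inv_closed m_assoc rc)
    then show ?thesis using that inverts[OF that(2)] by (auto simp: T_def)
  qed
  have TR: "s \<in> reciprocators G g" if "s \<in> T" for s
  proof -
    have "s \<otimes> g = inv g \<otimes> s" using T_inverts that gZ by blast
    then have "s \<otimes> g \<otimes> inv s = inv g" using Tc[OF that] g conj_cancel[of s g "inv g"] by blast
    then show ?thesis using Tc[OF that] by (simp add: reciprocators_def)
  qed
  let ?X = "{x \<in> conjugacy_class G g. t \<in> reciprocators G x}"
  let ?f = "\<lambda>(c, s). (c \<otimes> k s) \<otimes> g \<otimes> inv (c \<otimes> k s)"
  have conj_t: "(c \<otimes> k s) \<otimes> s \<otimes> inv (c \<otimes> k s) = t" if "c \<in> centralizer G t" "s \<in> T" for c s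
  proof -
    have c: "c \<in> carrier G" "c \<otimes> t = t \<otimes> c" using that by (auto simp: centralizer_def[of G t])
    then have "(c \<otimes> k s) \<otimes> s \<otimes> inv (c \<otimes> k s) = c \<otimes> t \<otimes> inv c"
      using that k conj_mult[of c "k s" s] Tc by simp
    then show ?thesis using c conj_cancel[of c t t] by simp
  qed
  have "inj_on ?f (centralizer G t \<times> T)"
  proof (rule inj_onI, clarsimp)
    fix c s c' s'
    assume c: "c \<in> centralizer G t" "c' \<in> centralizer G t" and s: "s \<in> T" "s' \<in> T"
      and eq: "c \<otimes> k s \<otimes> g \<otimes> inv (c \<otimes> k s) = c' \<otimes> k s' \<otimes> g \<otimes> inv (c' \<otimes> k s')"
    have cc: "c \<in> carrier G" "c' \<in> carrier G" using c by (auto simp: centralizer_def[of G t])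
    define z where "z = inv (c' \<otimes> k s') \<otimes> (c \<otimes> k s)"
    have z: "z \<in> ?Z" unfolding z_def
      using conj_eq_iff_centralizer[of "c \<otimes> k s" "c' \<otimes> k s'" g] eq cc k s by simp
    have ck: "c \<otimes> k s = c' \<otimes> k s' \<otimes> z" unfolding z_def using cc k s by (simp add: inv_mult_cancel)
    have "(c' \<otimes> k s') \<otimes> (z \<otimes> s \<otimes> inv z) \<otimes> inv (c' \<otimes> k s') = (c' \<otimes> k s') \<otimes> s' \<otimes> inv (c' \<otimes> k s')"
      using conj_t[OF c(1) s(1)] conj_t[OF c(2) s(2)] ck
        conj_mult[of "c' \<otimes> k s'" z s] cc k s z Tc by simp
    then have "z \<otimes> s \<otimes> inv z = s'"
      using cc k s z Tc by simp
    then have zs: "s \<otimes> inv z \<otimes> inv z = s'"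
      using T_inverts[OF s(1), of "inv z"] z by simp
    define y where "y = inv z"
    have y: "y \<in> ?Z" using z by (simp add: y_def)
    have zs: "s \<otimes> (y \<otimes> y) = s'" using zs y Tc[OF s(1)] by (simp add: y_def[symmetric] m_assoc)
    \<comment> \<open>If \<open>s\<close> and \<open>s'\<close> were different, \<open>e\<close> or its inverse would be a square.\<close>
    have "y \<otimes> y \<noteq> e" using e_nonsquare y by blast
    moreover have False if "r \<otimes> e \<otimes> (y \<otimes> y) = r"
    proof -
      have "r \<otimes> (e \<otimes> (y \<otimes> y)) = r \<otimes> \<one>" using that y by (simp add: m_assoc)
      then have "e \<otimes> (y \<otimes> y) = \<one>" using y by (subst (asm) l_cancel) auto
      then have "e = inv (y \<otimes> y)" using y inv_equality[of e "y \<otimes> y"] by simp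
      then have "inv y \<otimes> inv y = e" using y by (simp add: inv_mult_group)
      then show False using e_nonsquare y by auto
    qed
    ultimately have ss: "s = s'" using zs s y by (auto simp: T_def)
    then have "s \<otimes> (y \<otimes> y) = s \<otimes> \<one>" using zs Tc[OF s(1)] by simp
    then have "y \<otimes> y = \<one>" using y Tc[OF s(1)] by (subst (asm) l_cancel) auto
    then have "y = \<one>" using torsion_free y by blast
    then have "z = \<one>" using z by (simp add: y_def)
    then have "c \<otimes> k s = c' \<otimes> k s" using ck ss cc k s by simp
    then show "c = c' \<and> s = s'" using ss cc k s by simp
  qed
  moreover have "?f ` (centralizer G t \<times> T) = ?X"
  proof (intro equalityI subsetI)
    fix x assume "x \<in> ?f ` (centralizer G t \<times> T)"
    then obtain c s where cs: "c \<in> centralizer G t" "s \<in> T"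
      and x: "x = (c \<otimes> k s) \<otimes> g \<otimes> inv (c \<otimes> k s)" by auto
    have h: "c \<otimes> k s \<in> carrier G" using cs k by (auto simp: centralizer_def[of G t])
    then have "t \<in> reciprocators G x"
      using reciprocators_conj[OF h g Tc[OF cs(2)]] TR[OF cs(2)] conj_t[OF cs] x by simp
    moreover have "x \<in> conjugacy_class G g"
      using h x by (auto simp: conjugacy_class_def conjugate_def)
    ultimately show "x \<in> ?X" by simp
  next
    fix x assume "x \<in> ?X"
    then obtain h where h: "h \<in> carrier G" and x: "x = h \<otimes> g \<otimes> inv h"
      and tx: "t \<in> reciprocators G x" by (auto simp: conjugacy_class_def conjugate_def)
    define q where "q = inv h \<otimes> t \<otimes> h"
    have q: "q \<in> carrier G" "h \<otimes> q \<otimes> inv h = t"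
      using h by (simp_all add: q_def m_assoc inv_mult_cancel)
    then have "q \<in> reciprocators G g" using reciprocators_conj[OF h g q(1)] tx x by simp
    then obtain y s where y: "y \<in> ?Z" and s: "s \<in> {r, r \<otimes> e}" "q = inv y \<otimes> s \<otimes> y"
      using reciprocator_conj_cases[OF g r inverts comm e squares] by blast
    have sc: "s \<in> carrier G" using s by auto
    have hys: "(h \<otimes> inv y) \<otimes> s \<otimes> inv (h \<otimes> inv y) = t"
      using q(2) s(2) conj_mult[of h "inv y" s] h y sc by simp
    then have sT: "s \<in> T" using s(1) h y by (auto simp: T_def conjugate_def intro!: bexI[of _ "h \<otimes> inv y"])
    define c where "c = h \<otimes> inv y \<otimes> inv (k s)"
    have cc: "c \<in> carrier G" using h y k sT by (simp add: c_def)
    have ck: "c \<otimes> k s = h \<otimes> inv y" using h y k sT by (simp add: c_def m_assoc)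
    have "c \<otimes> t \<otimes> inv c = t"
      using hys conj_mult[of c "k s" s] k sT cc sc ck by simp
    then have "c \<in> centralizer G t" using cc conj_cancel[of c t t] by (simp add: centralizer_def[of G t])
    moreover have "(c \<otimes> k s) \<otimes> g \<otimes> inv (c \<otimes> k s) = x"
      unfolding ck x using conj_eq_iff_centralizer[of "h \<otimes> inv y" h g] h y
      by (simp add: m_assoc[symmetric])
    ultimately show "x \<in> ?f ` (centralizer G t \<times> T)" using sT by force
  qed
  ultimately have "card ?X = card (centralizer G t \<times> T)" by (metis (no_types, lifting) card_image)
  then show ?thesis by (simp add: card_cartesian_product T_def)
qed

text \<open>An injective homomorphism \<open>\<mu>\<close> to the positive reals with a least value \<open>\<mu> e > 1\<close> makes \<open>Z\<close> infinite
  cyclic with generator \<open>e\<close>. What the count needs is only that \<open>1\<close> and \<open>e\<close> represent \<open>Z\<close> modulo squares and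
  that \<open>Z\<close> is torsion free. An element with \<open>\<mu> z \<ge> 1\<close> is reduced by dividing by \<open>e\<close> twice, which does not
  change its class modulo squares, until \<open>\<mu> z\<close> is below the square of \<open>\<mu> e\<close>; the least value then forces \<open>z\<close>
  to be \<open>1\<close> or \<open>e\<close>.\<close>

lemma squares_from_least:
  fixes \<mu> :: "'a \<Rightarrow> real"
  assumes Z: "subgroup Z G"
    and pos: "\<And>z. z \<in> Z \<Longrightarrow> \<mu> z > 0"
    and hom: "\<And>y z. y \<in> Z \<Longrightarrow> z \<in> Z \<Longrightarrow> \<mu> (y \<otimes> z) = \<mu> y * \<mu> z"
    and inj: "\<And>z. z \<in> Z \<Longrightarrow> \<mu> z = 1 \<Longrightarrow> z = \<one>"
    and comm: "\<And>y z. y \<in> Z \<Longrightarrow> z \<in> Z \<Longrightarrow> y \<otimes> z = z \<otimes> y"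
    and e: "e \<in> Z" "\<mu> e > 1"
    and least: "\<And>z. z \<in> Z \<Longrightarrow> \<mu> z > 1 \<Longrightarrow> \<mu> e \<le> \<mu> z"
  shows "z \<in> Z \<Longrightarrow> \<exists>y\<in>Z. z = y \<otimes> y \<or> z = y \<otimes> y \<otimes> e"
    and "y \<in> Z \<Longrightarrow> y \<otimes> y \<noteq> e"
    and "y \<in> Z \<Longrightarrow> y \<otimes> y = \<one> \<Longrightarrow> y = \<one>"
proof -
  interpret Z: subgroup Z G by (rule Z)
  have one: "\<mu> \<one> = 1" using hom[of \<one> \<one>] pos[of \<one>] by simp
  have inv: "\<mu> (inv z) = 1 / \<mu> z" if "z \<in> Z" for z
    using hom[of z "inv z"] that one pos[OF that] by (simp add: field_simps)
  have eq: "y = z" if "y \<in> Z" "z \<in> Z" "\<mu> y = \<mu> z" for y z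
  proof -
    have "y \<otimes> inv z = \<one>" using inj[of "y \<otimes> inv z"] hom[of y "inv z"] inv[of z] that pos[of z] by simp
    then show ?thesis using that by (metis Z.mem_carrier inv_equality inv_inv Z.m_inv_closed)
  qed
  have large: "\<exists>y\<in>Z. z = y \<otimes> y \<or> z = y \<otimes> y \<otimes> e"
    if "z \<in> Z" "1 \<le> \<mu> z" "\<mu> z < \<mu> e ^ n" for n z
    using that
  proof (induction n arbitrary: z)
    case 0
    then show ?case by simp
  next
    case (Suc n)
    \<comment> \<open>Dividing by \<open>e\<close> twice keeps the class modulo squares.\<close>
    let ?y = "z \<otimes> inv e \<otimes> inv e"
    have y: "?y \<in> Z" "\<mu> ?y = \<mu> z / (\<mu> e * \<mu> e)" "\<mu> (z \<otimes> inv e) = \<mu> z / \<mu> e"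
      using Suc e by (simp_all add: hom inv)
    have zy: "z = ?y \<otimes> (e \<otimes> e)" using Suc e by (simp add: m_assoc inv_mult_cancel)
    consider "\<mu> z < \<mu> e" | "\<mu> e \<le> \<mu> z" "\<mu> z < \<mu> e * \<mu> e" | "\<mu> e * \<mu> e \<le> \<mu> z" by linarith
    then show ?case
    proof cases
      case 1
      then have "\<mu> z = 1" using least[OF Suc.prems(1)] Suc.prems(2) by linarith
      then have "z = \<one>" using inj Suc.prems(1) by blast
      then show ?thesis by (intro bexI[of _ \<one>]) auto
    next
      case 2
      have ze: "z \<otimes> inv e \<in> Z" using Suc.prems(1) e by simp
      have "1 \<le> \<mu> (z \<otimes> inv e)" "\<mu> (z \<otimes> inv e) < \<mu> e"
        unfolding y(3) using 2 e by (simp_all add: divide_less_eq)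
      then have "\<mu> (z \<otimes> inv e) = 1" using least[OF ze] by linarith
      then have "\<mu> z = \<mu> e" using y(3) e by simp
      then have "z = e" using eq Suc.prems(1) e by blast
      then show ?thesis using e by (intro bexI[of _ \<one>]) auto
    next
      case 3
      have "\<mu> z / (\<mu> e * \<mu> e) \<le> \<mu> z / \<mu> e" using e Suc
        by (intro divide_left_mono) auto
      also have "\<dots> < \<mu> e ^ n" using Suc e by (simp add: field_simps)
      finally have "\<mu> ?y < \<mu> e ^ n" using y by simp
      moreover have "0 < \<mu> e * \<mu> e" using e(2) by simp
      then have "1 \<le> \<mu> ?y" unfolding y(2) using 3 by (simp add: le_divide_eq)
      ultimately obtain w where w: "w \<in> Z" "?y = w \<otimes> w \<or> ?y = w \<otimes> w \<otimes> e"
        using Suc.IH[OF y(1)] by blast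
      have "w \<otimes> w \<otimes> (e \<otimes> e) = (w \<otimes> e) \<otimes> (w \<otimes> e)"
        using w(1) e(1) comm[OF w(1) e(1)] m_assoc[of w e w] m_assoc[of w w "e \<otimes> e"]
          m_assoc[of w e e] m_assoc[of e w e] m_assoc[of w e "w \<otimes> e"] by simp
      moreover have "w \<otimes> w \<otimes> e \<otimes> (e \<otimes> e) = (w \<otimes> w \<otimes> (e \<otimes> e)) \<otimes> e"
        using w e by (simp add: m_assoc)
      ultimately have "z = (w \<otimes> e) \<otimes> (w \<otimes> e) \<or> z = (w \<otimes> e) \<otimes> (w \<otimes> e) \<otimes> e"
        using w(2) zy by (elim disjE) (simp_all only:, metis+)
      then show ?thesis using w e by (intro bexI[of _ "w \<otimes> e"]) auto
    qed
  qed
  show "\<exists>y\<in>Z. z = y \<otimes> y \<or> z = y \<otimes> y \<otimes> e" if z: "z \<in> Z"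
  proof (cases "1 \<le> \<mu> z")
    case True
    moreover obtain n where "\<mu> z < \<mu> e ^ n" using real_arch_pow[OF e(2)] by blast
    ultimately show ?thesis using large[OF z] by blast
  next
    case False
    then have "1 \<le> \<mu> (inv z)" using inv[OF z] pos[OF z] by simp
    moreover obtain n where "\<mu> (inv z) < \<mu> e ^ n" using real_arch_pow[OF e(2)] by blast
    ultimately obtain w where w: "w \<in> Z" "inv z = w \<otimes> w \<or> inv z = w \<otimes> w \<otimes> e"
      using large[OF Z.m_inv_closed[OF z]] by blast
    have pw: "\<mu> w > 0" "\<mu> e > 0" using pos w e by auto
    from w(2) show ?thesis
    proof
      assume "inv z = w \<otimes> w"
      then have "1 / \<mu> z = \<mu> w * \<mu> w" using inv[OF z] hom[OF w(1) w(1)] by simp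
      then have "\<mu> z = 1 / (\<mu> w * \<mu> w)" by (metis div_by_1 divide_divide_eq_right mult_1)
      then have "\<mu> z = \<mu> (inv w \<otimes> inv w)" using hom inv w(1) by simp
      then have "z = inv w \<otimes> inv w" by (rule eq[OF z, rotated]) (use w(1) in simp)
      then show ?thesis using w by auto
    next
      assume "inv z = w \<otimes> w \<otimes> e"
      then have "1 / \<mu> z = \<mu> w * \<mu> w * \<mu> e" using inv[OF z] hom w(1) e(1) by simp
      moreover have "\<mu> (inv w \<otimes> inv e \<otimes> (inv w \<otimes> inv e) \<otimes> e) = 1 / (\<mu> w * \<mu> w * \<mu> e)"
        using w(1) e(1) pw by (simp add: hom inv)
      ultimately have "\<mu> z = \<mu> (inv w \<otimes> inv e \<otimes> (inv w \<otimes> inv e) \<otimes> e)"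
        by (metis div_by_1 divide_divide_eq_right mult_1)
      then have "z = inv w \<otimes> inv e \<otimes> (inv w \<otimes> inv e) \<otimes> e"
        by (rule eq[OF z, rotated]) (use w(1) e(1) in simp)
      then show ?thesis using w e by (intro bexI[of _ "inv w \<otimes> inv e"]) auto
    qed
  qed
  show "y \<otimes> y \<noteq> e" if y: "y \<in> Z"
  proof
    assume ye: "y \<otimes> y = e"
    then have sq: "\<mu> y * \<mu> y = \<mu> e" using hom[OF y y] by simp
    show False
    proof (cases "\<mu> y > 1")
      case True
      then have "\<mu> y * 1 < \<mu> y * \<mu> y" by (intro mult_strict_left_mono) auto
      then show False using sq least[OF y True] by simp
    next
      case False
      then have "\<mu> y * \<mu> y \<le> 1 * 1" using pos[OF y] by (intro mult_mono) auto
      then show False using sq e by simp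
    qed
  qed
  show "y = \<one>" if y: "y \<in> Z" "y \<otimes> y = \<one>"
  proof -
    have "\<mu> y * \<mu> y = 1" using hom[of y y] y one by simp
    then have "(\<mu> y - 1) * (\<mu> y + 1) = 0" by (simp add: algebra_simps)
    then have "\<mu> y = 1" using pos[OF y(1)] by (simp add: add_nonneg_eq_0_iff)
    then show ?thesis using inj y by blast
  qed
qed

end

section \<open>Centralizers and reciprocators of hyperbolic elements\<close>

text \<open>The matrix \<open>x + y A\<close>. For non-scalar \<open>A\<close> these are all the matrices that commute with \<open>A\<close>.\<close>

definition lin :: "real \<Rightarrow> real \<Rightarrow> real^2^2 \<Rightarrow> real^2^2" where
  "lin x y A = mat22 (x + y * A$1$1) (y * A$1$2) (y * A$2$1) (x + y * A$2$2)"

lemma lin_mat22 [simp]: "lin x y (mat22 a b c d) = mat22 (x + y * a) (y * b) (y * c) (x + y * d)"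
  by (simp add: lin_def)

text \<open>If \<open>R\<close> has trace zero, polarizing the Cayley-Hamilton identity gives
  \<open>R A + A R = trace A R + trace (R A)\<close>, that is \<open>R A - adj A R = trace (R A)\<close>, the last
  trace being multiplied by the identity.\<close>

lemma intertwines_inverse_if:
  assumes "trace R = 0" "trace (R ** A) = 0"
  shows "R ** A = adj A ** R"
proof -
  obtain a b c d x y z w where eq: "A = mat22 a b c d" "R = mat22 x y z w"
    by (metis mat22_cases)
  have "w = - x" "x * a + y * c + (z * b + w * d) = 0" using assms eq by auto
  then show ?thesis unfolding eq by (simp add: algebra_simps)
qed

text \<open>In the converse direction the four entries say that \<open>trace R\<close> times the traceless part of \<open>A\<close>
  vanishes; the traceless part is not zero because \<open>A\<close> is not scalar.\<close>

lemma intertwines_inverse_iff: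
  assumes "\<bar>trace A\<bar> > 2" "det A = 1"
  shows "R ** A = adj A ** R \<longleftrightarrow> trace R = 0 \<and> trace (R ** A) = 0"
proof
  assume h: "R ** A = adj A ** R"
  obtain a b c d x y z w where eq: "A = mat22 a b c d" "R = mat22 x y z w"
    by (metis mat22_cases)
  have e: "x * a + y * c = d * x - b * z" "x * b + y * d = d * y - b * w"
     "z * a + w * c = a * z - c * x" "z * b + w * d = a * w - c * y"
    using h unfolding eq by simp_all
  have "b * (x + w) = 0" "c * (x + w) = 0" "(a - d) * (x + w) = 0"
    using e by (simp_all add: algebra_simps)
  then have "x + w = 0" using hyperbolic_nonscalar[of a b c d] assms eq by auto
  moreover from this have "w = - x" by simp
  ultimately show "trace R = 0 \<and> trace (R ** A) = 0"
    unfolding eq using e by (simp add: algebra_simps)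
qed (use intertwines_inverse_if in blast)

text \<open>Being a reciprocator becomes one linear equation on the entries of \<open>A\<close>, once \<open>R\<close> is known to be an
  involution. The sign ambiguity of PSL(2,R) is harmless: \<open>R A adj R = - adj A\<close> is excluded by
  comparing traces.\<close>

lemma reciprocators_psl_iff:
  assumes A: "psl A \<in> carrier (Hecke p)" "det A = 1" "\<bar>trace A\<bar> > 2"
    and R: "psl R \<in> carrier (Hecke p)" "det R = 1"
  shows "psl R \<in> reciprocators (Hecke p) (psl A) \<longleftrightarrow> trace R = 0 \<and> trace (R ** A) = 0"
proof -
  have RAR: "R ** A ** adj R = Y \<longleftrightarrow> R ** A = Y ** R" for Y
  proof
    assume "R ** A ** adj R = Y"
    then have "Y ** R = R ** A ** (adj R ** R)" by (simp add: matrix_mul_assoc)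
    then show "R ** A = Y ** R" using adj_mult[OF R(2)] by simp
  next
    assume "R ** A = Y ** R"
    then have "R ** A ** adj R = Y ** (R ** adj R)" by (simp add: matrix_mul_assoc)
    then show "R ** A ** adj R = Y" using adj_mult[OF R(2)] by simp
  qed
  have "adj A \<noteq> - (R ** A ** adj R)"
  proof
    assume "adj A = - (R ** A ** adj R)"
    then have "trace (adj A) = - trace A" using trace_conj[OF R(2)] by simp
    moreover have "trace (adj A) = trace A" by (cases A rule: mat22_cases) simp
    ultimately show False using A(3) by simp
  qed
  then have "psl R \<in> reciprocators (Hecke p) (psl A) \<longleftrightarrow> R ** A ** adj R = adj A"
    using A R by (auto simp: reciprocators_def Hecke_inv psl_eq_iff)
  then show ?thesis using RAR intertwines_inverse_iff[OF A(3,2)] by simp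
qed

text \<open>The multiplier \<open>y\<close> is read off from an entry where the traceless part of \<open>A\<close> does not vanish.\<close>

lemma commuting_lin:
  assumes "\<bar>trace A\<bar> > 2" "det A = 1" "B ** A = A ** B"
  obtains x y where "B = lin x y A"
proof -
  obtain a b c d x y z w where eq: "A = mat22 a b c d" "B = mat22 x y z w"
    by (metis mat22_cases)
  have e: "y * c = b * z" "x * b + y * d = a * y + b * w" "z * a + w * c = c * x + d * z"
    using assms(3) unfolding eq by simp_all
  have "\<not> (b = 0 \<and> c = 0 \<and> a = d)" using hyperbolic_nonscalar[of a b c d] assms(1,2) unfolding eq by blast
  then consider "b \<noteq> 0" | "c \<noteq> 0" | "b = 0" "c = 0" "a \<noteq> d" by auto
  then show ?thesis
  proof cases
    case 1
    then have "B = lin (x - y / b * a) (y / b) A" unfolding eq using e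
      by (simp add: field_simps)
    then show ?thesis by (rule that)
  next
    case 2
    then have "B = lin (x - z / c * a) (z / c) A" unfolding eq using e
      by (simp add: field_simps)
    then show ?thesis by (rule that)
  next
    case 3
    have "(a - d) * y = 0" "(a - d) * z = 0" using e 3 by (simp_all add: algebra_simps)
    then have "y = 0" "z = 0" using 3 by simp_all
    moreover define k where "k = (x - w) / (a - d)"
    moreover from this have "k * (a - d) = x - w" using 3 by simp
    then have "w = x - k * a + k * d" by (simp add: algebra_simps)
    ultimately have "B = lin (x - k * a) k A" unfolding eq using 3 by simp
    then show ?thesis by (rule that)
  qed
qed

lemma centralizer_psl:
  assumes A: "psl A \<in> carrier (Hecke p)" "det A = 1" "\<bar>trace A\<bar> > 2"
    and z: "z \<in> centralizer (Hecke p) (psl A)"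
  obtains x y where "z = psl (lin x y A)" "det (lin x y A) = 1"
proof -
  have zc: "z \<in> carrier (Hecke p)" "z \<otimes>\<^bsub>Hecke p\<^esub> psl A = psl A \<otimes>\<^bsub>Hecke p\<^esub> z"
    using z by (auto simp: centralizer_def)
  then obtain B where B: "z = psl B" "det B = 1" by (metis carrier_Hecke_psl)
  have "psl (B ** A) = psl (A ** B)" using zc B by simp
  moreover have "B ** A \<noteq> - (A ** B)"
  proof
    assume eq: "B ** A = - (A ** B)"
    have "trace A = trace (B ** A ** adj B)" using trace_conj B by simp
    also have "\<dots> = - trace (A ** (B ** adj B))" by (simp add: eq neg_mult matrix_mul_assoc)
    also have "\<dots> = - trace A" using adj_mult[OF B(2)] by simp
    finally show False using A by simp
  qed
  ultimately have "B ** A = A ** B" by (simp add: psl_eq_iff)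
  then obtain x y where "B = lin x y A" by (rule commuting_lin[OF A(3,2)])
  then show ?thesis using B that by simp
qed

lemma lin_commute: "lin x y A ** lin x' y' A = lin x' y' A ** lin x y A"
  by (cases A rule: mat22_cases) (simp add: algebra_simps)

section \<open>The eigenvalue character\<close>

definition dilation :: "real^2^2 \<Rightarrow> real" where
  "dilation A = (trace A + sqrt ((trace A)\<^sup>2 - 4)) / 2"

text \<open>The linear functional that sends \<open>x + y A\<close> to \<open>x + y u\<close>, where \<open>u = dilation A\<close> is the larger
  eigenvalue of \<open>A\<close>: the eigenvalue of a matrix commuting with \<open>A\<close> on the expanding eigenline.\<close>

definition eigval :: "real^2^2 \<Rightarrow> real^2^2 \<Rightarrow> real" where
  "eigval A B = trace B / 2 + (trace (A ** B) - trace A * trace B / 2) / sqrt ((trace A)\<^sup>2 - 4)"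

lemma dilation:
  assumes "trace A > 2"
  shows "dilation A > 1" "(dilation A)\<^sup>2 = trace A * dilation A - 1"
proof -
  let ?t = "trace A" let ?s = "sqrt (?t\<^sup>2 - 4)"
  have "2 * 2 < ?t * ?t" using assms by (intro mult_strict_mono) auto
  then have D: "?t\<^sup>2 - 4 > 0" by (simp add: power2_eq_square)
  then have s: "?s > 0" by (simp only: real_sqrt_gt_0_iff)
  have half: "a > 2 \<Longrightarrow> b > 0 \<Longrightarrow> (a + b) / 2 > 1" for a b :: real by simp
  show "dilation A > 1" unfolding dilation_def by (rule half[OF assms s])
  have "?s\<^sup>2 = ?t\<^sup>2 - 4" using D by simp
  then show "(dilation A)\<^sup>2 = ?t * dilation A - 1"
    by (simp add: dilation_def power2_eq_square field_simps)
qed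

lemma eigval_lin:
  assumes "trace A > 2" "det A = 1"
  shows "eigval A (lin x y A) = x + y * dilation A"
proof -
  let ?t = "trace A" let ?s = "sqrt (?t\<^sup>2 - 4)"
  have "2 * 2 < ?t * ?t" using assms by (intro mult_strict_mono) auto
  then have "?t\<^sup>2 - 4 > 0" by (simp add: power2_eq_square)
  then have s: "?s \<noteq> 0" "?s * ?s = ?t\<^sup>2 - 4" by auto
  have 1: "trace (lin x y A) = 2 * x + y * ?t"
    by (cases A rule: mat22_cases) (simp add: algebra_simps)
  have 2: "trace (A ** lin x y A) = x * ?t + y * (?t\<^sup>2 - 2)"
  proof -
    obtain a b c d where A: "A = mat22 a b c d" by (rule mat22_cases)
    have "trace (A ** lin x y A) - (x * trace A + y * ((trace A)\<^sup>2 - 2)) = 2 * y * (1 - det A)"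
      unfolding A by (simp add: power2_eq_square algebra_simps)
    then show ?thesis using assms by simp
  qed
  have "eigval A (lin x y A) = x + y * ?t / 2 + y * (?t\<^sup>2 - 4) / 2 / ?s"
    unfolding eigval_def 1 2 by (simp add: power2_eq_square field_simps)
  also have "\<dots> = x + y * dilation A"
  proof -
    have "x + y * t / 2 + y * D / 2 / s = x + y * ((t + s) / 2)" if "s \<noteq> 0" "s * s = D" for s t D
      using that(1) unfolding that(2)[symmetric] by (simp add: field_simps)
    then show ?thesis using s unfolding dilation_def by blast
  qed
  finally show ?thesis .
qed

lemma lin_mult:
  assumes "det A = 1"
  shows "lin x y A ** lin x' y' A = lin (x * x' - y * y') (x * y' + x' * y + y * y' * trace A) A"
proof -
  obtain a b c d where A: "A = mat22 a b c d" by (rule mat22_cases)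
  have ad: "a * d = 1 + b * c" using assms A by simp
  have "y * y' * (a * d) = y * y' + y * y' * (b * c)" unfolding ad by (simp add: algebra_simps)
  then show ?thesis unfolding A by (simp add: algebra_simps)
qed

text \<open>The two factors are the eigenvalues of \<open>x + y A\<close>.\<close>

lemma det_lin:
  assumes "trace A > 2" "det A = 1"
  shows "det (lin x y A) = (x + y * dilation A) * (x + y / dilation A)"
proof -
  obtain a b c d where A: "A = mat22 a b c d" by (rule mat22_cases)
  let ?u = "dilation A"
  have "det (lin x y A) - (x\<^sup>2 + x * y * trace A + y\<^sup>2) = y\<^sup>2 * (det A - 1)"
    unfolding A by (simp add: power2_eq_square algebra_simps)
  then have "det (lin x y A) = x\<^sup>2 + x * y * trace A + y\<^sup>2" using assms(2) by simp
  moreover have "?u \<noteq> 0" using dilation[OF assms(1)] by simp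
  moreover from this have "trace A = ?u + 1 / ?u"
    using dilation[OF assms(1)] by (simp add: field_simps power2_eq_square)
  ultimately show ?thesis by (simp add: power2_eq_square field_simps)
qed

text \<open>The absolute value removes the dependence on the representative.\<close>

definition character :: "real^2^2 \<Rightarrow> (real^2^2) set \<Rightarrow> real" where
  "character A z = \<bar>eigval A (SOME B. B \<in> z)\<bar>"

lemma character_psl:
  assumes "trace A > 2" "det A = 1"
  shows "character A (psl (lin x y A)) = \<bar>x + y * dilation A\<bar>"
proof -
  have "(SOME B. B \<in> psl (lin x y A)) \<in> psl (lin x y A)"
    by (rule someI[of _ "lin x y A"]) (simp add: psl_def)
  then have "(SOME B. B \<in> psl (lin x y A)) \<in> {lin x y A, lin (- x) (- y) A}"
    by (simp add: psl_def lin_def)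
  then show ?thesis unfolding character_def using eigval_lin[OF assms] by auto
qed

definition entry_bounded :: "real \<Rightarrow> real^2^2 \<Rightarrow> bool" where
  "entry_bounded B A \<longleftrightarrow> (\<forall>i j. \<bar>A$i$j\<bar> \<le> B)"

lemma entry_bounded_mat22 [simp]:
  "entry_bounded B (mat22 a b c d) \<longleftrightarrow> \<bar>a\<bar> \<le> B \<and> \<bar>b\<bar> \<le> B \<and> \<bar>c\<bar> \<le> B \<and> \<bar>d\<bar> \<le> B"
  by (auto simp: entry_bounded_def forall_2)

text \<open>The eigenvalues \<open>v = x + y u\<close> and \<open>v' = x + y / u\<close> are bounded by \<open>u\<close> and \<open>1\<close>, and \<open>x\<close> and \<open>y\<close> are linear in
  them. So only boundedly large matrices can have a character value between 1 and \<open>u\<close>.\<close>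

lemma entry_bounded_lin:
  assumes "trace A > 2" "det A = 1" "det (lin x y A) = 1"
    and "1 < \<bar>x + y * dilation A\<bar>" "\<bar>x + y * dilation A\<bar> \<le> dilation A"
    and A: "entry_bounded C A"
  shows "entry_bounded
    (dilation A + (dilation A + 1) / (dilation A - 1 / dilation A) * (dilation A + C)) (lin x y A)"
proof -
  let ?u = "dilation A"
  define v where "v = x + y * ?u"
  define v' where "v' = x + y / ?u"
  have u: "?u > 1" using dilation assms by blast
  then have u': "?u - 1 / ?u > 0" by (simp add: field_simps) (metis less_1_mult)
  have vv: "v * v' = 1" using det_lin[OF assms(1,2)] assms(3) by (simp add: v_def v'_def)
  have v: "1 < \<bar>v\<bar>" "\<bar>v\<bar> \<le> ?u" using assms by (simp_all add: v_def)
  have "\<bar>v\<bar> * \<bar>v'\<bar> = 1" using vv by (simp add: abs_mult[symmetric])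
  then have v': "\<bar>v'\<bar> \<le> 1" using v by (metis abs_ge_zero less_eq_real_def mult_le_cancel_right1 not_le)
  define k where "k = (?u + 1) / (?u - 1 / ?u)"
  have "y * (?u - 1 / ?u) = v - v'" by (simp add: v_def v'_def algebra_simps)
  then have "y = (v - v') / (?u - 1 / ?u)" using u' by (simp add: field_simps)
  then have y: "\<bar>y\<bar> \<le> k"
    unfolding k_def using u' v v' by (simp add: abs_divide divide_right_mono)
  have x: "\<bar>x\<bar> \<le> ?u + k * ?u"
  proof -
    have "\<bar>x\<bar> = \<bar>v - y * ?u\<bar>" by (simp add: v_def)
    also have "\<dots> \<le> \<bar>v\<bar> + \<bar>y\<bar> * ?u" using u by (metis abs_mult abs_of_pos abs_triangle_ineq4 less_trans zero_less_one)
    also have "\<dots> \<le> ?u + k * ?u" using v y u by (intro add_mono mult_right_mono) auto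
    finally show ?thesis .
  qed
  have C: "\<bar>A$i$j\<bar> \<le> C" for i j using A by (simp add: entry_bounded_def)
  have k: "k \<ge> 0" using y by linarith
  have yA: "\<bar>y * A$i$j\<bar> \<le> k * C" for i j
    unfolding abs_mult using y C k by (intro mult_mono) auto
  have "0 \<le> k * ?u" "0 \<le> k * C" using k u C[of 1 1] by (auto intro: mult_nonneg_nonneg)
  then have *: "\<bar>y * A$i$j\<bar> \<le> ?u + (k * ?u + k * C)" "\<bar>x + y * A$i$j\<bar> \<le> ?u + (k * ?u + k * C)" for i j
    using yA[of i j] x u abs_triangle_ineq[of x "y * A$i$j"] by linarith+
  have "entry_bounded (?u + k * (?u + C)) (lin x y A)"
    unfolding lin_def using * by (simp add: algebra_simps)
  then show ?thesis by (simp add: k_def)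
qed

text \<open>The centralizer of a hyperbolic element embeds into the positive reals by its character. By
  discreteness only finitely many of its elements have a character value in the interval from 1 to
  the value at \<open>A\<close>, hence there is a least value above 1.\<close>

lemma hyperbolic_centralizer_generator:
  assumes fin: "\<And>B. finite {z \<in> carrier (Hecke p). \<exists>M\<in>z. entry_bounded B M}"
    and A: "psl A \<in> carrier (Hecke p)" "det A = 1" "trace A > 2"
  obtains e where "e \<in> centralizer (Hecke p) (psl A)"
    "\<And>z. z \<in> centralizer (Hecke p) (psl A) \<Longrightarrow> \<exists>y\<in>centralizer (Hecke p) (psl A).
       z = y \<otimes>\<^bsub>Hecke p\<^esub> y \<or> z = y \<otimes>\<^bsub>Hecke p\<^esub> y \<otimes>\<^bsub>Hecke p\<^esub> e"
    "\<And>y. y \<in> centralizer (Hecke p) (psl A) \<Longrightarrow> y \<otimes>\<^bsub>Hecke p\<^esub> y \<noteq> e"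
    "\<And>y. y \<in> centralizer (Hecke p) (psl A) \<Longrightarrow> y \<otimes>\<^bsub>Hecke p\<^esub> y = \<one>\<^bsub>Hecke p\<^esub> \<Longrightarrow> y = \<one>\<^bsub>Hecke p\<^esub>"
    "\<And>y z. y \<in> centralizer (Hecke p) (psl A) \<Longrightarrow> z \<in> centralizer (Hecke p) (psl A) \<Longrightarrow>
       y \<otimes>\<^bsub>Hecke p\<^esub> z = z \<otimes>\<^bsub>Hecke p\<^esub> y"
proof -
  interpret H: group "Hecke p" by (rule group_Hecke)
  let ?Z = "centralizer (Hecke p) (psl A)" and ?u = "dilation A"
  let ?\<mu> = "character A"
  have A': "\<bar>trace A\<bar> > 2" using A by simp
  have sub: "subgroup ?Z (Hecke p)"
  proof (rule H.subgroupI)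
    show "?Z \<subseteq> carrier (Hecke p)" by (auto simp: centralizer_def)
    show "?Z \<noteq> {}" using H.centralizer_closed(3)[OF A(1)] by blast
  qed (use H.centralizer_closed[OF A(1)] in blast)+
  have lin: "\<exists>x y. z = psl (lin x y A) \<and> det (lin x y A) = 1 \<and> ?\<mu> z = \<bar>x + y * ?u\<bar>"
    if "z \<in> ?Z" for z
    using centralizer_psl[OF A(1,2) A' that] character_psl[OF A(3,2)] by metis
  have pos: "?\<mu> z > 0" if "z \<in> ?Z" for z
    using lin[OF that] det_lin[OF A(3,2)] by auto
  have hom: "?\<mu> (y \<otimes>\<^bsub>Hecke p\<^esub> z) = ?\<mu> y * ?\<mu> z" if yz: "y \<in> ?Z" "z \<in> ?Z" for y z
  proof -
    obtain a b c d where y: "y = psl (lin a b A)" "?\<mu> y = \<bar>a + b * ?u\<bar>"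
      and z: "z = psl (lin c d A)" "?\<mu> z = \<bar>c + d * ?u\<bar>"
      using lin[OF yz(1)] lin[OF yz(2)] by blast
    have "?\<mu> (y \<otimes>\<^bsub>Hecke p\<^esub> z) = \<bar>a * c - b * d + (a * d + c * b + b * d * trace A) * ?u\<bar>"
      using y z lin_mult[OF A(2)] character_psl[OF A(3,2)] by simp
    also have "a * c - b * d + (a * d + c * b + b * d * trace A) * ?u = (a + b * ?u) * (c + d * ?u)"
    proof -
      have "b * d * ?u\<^sup>2 = b * d * (trace A * ?u - 1)" by (simp only: dilation(2)[OF A(3)])
      then show ?thesis by (simp add: power2_eq_square algebra_simps)
    qed
    finally show ?thesis using y z by (simp add: abs_mult)
  qed
  have inj: "z = \<one>\<^bsub>Hecke p\<^esub>" if zZ: "z \<in> ?Z" and z1: "?\<mu> z = 1" for z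
  proof -
    obtain a b where z: "z = psl (lin a b A)" "det (lin a b A) = 1" "\<bar>a + b * ?u\<bar> = 1"
      using lin[OF zZ] z1 by auto
    have "(a + b * ?u) * (a + b / ?u) = 1" using det_lin[OF A(3,2)] z by simp
    moreover have "w = v" if "v * w = 1" "\<bar>v\<bar> = 1" for v w :: real
    proof -
      have "v = 1 \<or> v = - 1" using that(2) by linarith
      then show ?thesis using that(1) by auto
    qed
    ultimately have eq: "a + b / ?u = a + b * ?u" using z(3) by blast
    have u: "?u > 1" using dilation[OF A(3)] by simp
    then have "b = b * (?u * ?u)" using eq by (simp add: field_simps)
    then have "b * (?u * ?u - 1) = 0" by (simp add: algebra_simps)
    moreover have "?u * ?u > 1" using u by (metis less_1_mult)
    ultimately have "b = 0" by simp
    then have "a = 1 \<or> a = -1" using z(3) by auto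
    then have "lin a b A = mat 1 \<or> lin a b A = - mat 1"
      using \<open>b = 0\<close> by (auto simp: lin_def mat22_one)
    then show ?thesis using z by (auto simp: Hecke_one)
  qed
  have comm: "y \<otimes>\<^bsub>Hecke p\<^esub> z = z \<otimes>\<^bsub>Hecke p\<^esub> y" if yz: "y \<in> ?Z" "z \<in> ?Z" for y z
  proof -
    obtain a b c d where "y = psl (lin a b A)" "z = psl (lin c d A)"
      using lin[OF yz(1)] lin[OF yz(2)] by blast
    then show ?thesis using lin_commute by simp
  qed
  define S where "S = {z \<in> ?Z. 1 < ?\<mu> z \<and> ?\<mu> z \<le> ?u}"
  obtain C where C: "entry_bounded C A"
  proof -
    obtain a b c d where "A = mat22 a b c d" by (rule mat22_cases)
    then have "entry_bounded (\<bar>a\<bar> + \<bar>b\<bar> + \<bar>c\<bar> + \<bar>d\<bar>) A" by simp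
    then show ?thesis by (rule that)
  qed
  have "finite S"
  proof (rule finite_subset[OF _ fin])
    show "S \<subseteq> {z \<in> carrier (Hecke p). \<exists>M\<in>z. entry_bounded (?u + (?u + 1) / (?u - 1 / ?u) * (?u + C)) M}"
    proof
      fix z assume z: "z \<in> S"
      then obtain x y where xy: "z = psl (lin x y A)" "det (lin x y A) = 1" "?\<mu> z = \<bar>x + y * ?u\<bar>"
        using lin unfolding S_def by blast
      then have "entry_bounded (?u + (?u + 1) / (?u - 1 / ?u) * (?u + C)) (lin x y A)"
        using entry_bounded_lin[OF A(3,2) xy(2) _ _ C] z by (simp add: S_def)
      moreover have "lin x y A \<in> z" using xy by (simp add: psl_def)
      ultimately show "z \<in> {z \<in> carrier (Hecke p). \<exists>M\<in>z. entry_bounded (?u + (?u + 1) / (?u - 1 / ?u) * (?u + C)) M}"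
        using z by (auto simp: S_def centralizer_def)
    qed
  qed
  moreover have "psl A \<in> S"
  proof -
    have "lin 0 1 A = A" by (cases A rule: mat22_cases) simp
    then show ?thesis using character_psl[OF A(3,2), of 0 1] dilation[OF A(3)] A(1)
      by (simp add: S_def centralizer_def)
  qed
  ultimately have S: "finite S" "S \<noteq> {}" by auto
  define e where "e = arg_min_on ?\<mu> S"
  have e: "e \<in> S" "\<And>z. z \<in> S \<Longrightarrow> ?\<mu> e \<le> ?\<mu> z"
    using arg_min_if_finite[OF S, of ?\<mu>] unfolding e_def[symmetric] by (auto simp: not_less)
  have least: "?\<mu> e \<le> ?\<mu> z" if "z \<in> ?Z" "?\<mu> z > 1" for z
  proof (cases "?\<mu> z \<le> ?u")
    case True
    then show ?thesis using e that by (simp add: S_def)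
  next
    case False
    moreover have "?\<mu> e \<le> ?u" using e by (simp add: S_def)
    ultimately show ?thesis by linarith
  qed
  have eZ: "e \<in> ?Z" "?\<mu> e > 1" using e by (auto simp: S_def)
  note squares = H.squares_from_least[OF sub pos hom inj comm eZ least]
  show ?thesis by (rule that[OF eZ(1) squares comm])
qed

text \<open>A reciprocator \<open>R\<close> satisfies \<open>trace R = 0\<close> and \<open>trace (R A) = 0\<close>, so \<open>trace (R (x + y A)) = 0\<close> as well.\<close>

lemma centralizer_inverted:
  assumes A: "psl A \<in> carrier (Hecke p)" "det A = 1" "\<bar>trace A\<bar> > 2"
    and r: "r \<in> reciprocators (Hecke p) (psl A)"
    and z: "z \<in> centralizer (Hecke p) (psl A)"
  shows "r \<otimes>\<^bsub>Hecke p\<^esub> z = inv\<^bsub>Hecke p\<^esub> z \<otimes>\<^bsub>Hecke p\<^esub> r"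
proof -
  have "r \<in> carrier (Hecke p)" using r by (simp add: reciprocators_def)
  then obtain R where R: "r = psl R" "det R = 1" by (rule carrier_Hecke_psl)
  then have tr: "trace R = 0" "trace (R ** A) = 0"
    using reciprocators_psl_iff[OF A] r \<open>r \<in> carrier (Hecke p)\<close> by auto
  obtain x y where B: "z = psl (lin x y A)" "det (lin x y A) = 1"
    by (rule centralizer_psl[OF A z])
  have "trace (R ** lin x y A) = x * trace R + y * trace (R ** A)"
    by (cases A rule: mat22_cases, cases R rule: mat22_cases) (simp add: algebra_simps)
  then have "R ** lin x y A = adj (lin x y A) ** R"
    using tr intertwines_inverse_if by simp
  moreover have "psl (lin x y A) \<in> carrier (Hecke p)" using z B by (simp add: centralizer_def)
  ultimately show ?thesis using R B Hecke_inv by simp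
qed

section \<open>Powers of the rotation as sine matrices\<close>

text \<open>The ratio \<open>sin (x t) / sin t\<close> for \<open>t = pi / p\<close>; for positive integers \<open>x\<close> it is a Chebyshev polynomial of the second
  kind in the cosine of \<open>t\<close>.\<close>

definition sr :: "nat \<Rightarrow> real \<Rightarrow> real" where
  "sr p x = sin (x * (pi / real p)) / sin (pi / real p)"

definition J :: "real^2^2" where
  "J = mat22 0 (-1) 1 0"

text \<open>The \<open>k\<close>-th power of the matrix of \<open>gam p\<close>.\<close>

definition rot :: "nat \<Rightarrow> real \<Rightarrow> real^2^2" where
  "rot p k = mat22 (- sr p (k - 1)) (- sr p k) (sr p k) (sr p (k + 1))"

text \<open>Up to sign the matrix of \<open>iota\<close> times the \<open>k\<close>-th power of \<open>gam p\<close>. Its entries are nonnegative for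
  \<open>0 < k < p\<close>, which is the reason for using these products as letters.\<close>

definition letter :: "nat \<Rightarrow> real \<Rightarrow> real^2^2" where
  "letter p k = mat22 (sr p k) (sr p (k + 1)) (sr p (k - 1)) (sr p k)"

primrec word :: "nat \<Rightarrow> nat list \<Rightarrow> real^2^2" where
  "word p [] = mat 1"
| "word p (k # ks) = letter p (real k) ** word p ks"

lemma word_append: "word p (ks @ ls) = word p ks ** word p ls"
  by (induction ks) (simp_all add: matrix_mul_assoc)

lemma det_J [simp]: "det J = 1" by (simp add: J_def)
lemma J_J: "J ** J = - mat 1" by (simp add: J_def mat22_one)

lemma J_rot: "J ** rot p k = - letter p k"
  by (simp add: J_def rot_def letter_def)

lemma iota_eq: "iota = psl J"
  by (simp add: iota_def J_def)

lemma iota_carrier: "iota \<in> carrier (Hecke p)"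
  unfolding carrier_Hecke by (rule generate.incl) simp

text \<open>The four entries of the identity \<open>rot_add\<close> below are instances of this one formula.\<close>

lemma sin_product_shift:
  "sin (a - t) * sin (b - t) = sin a * sin b - sin (a + b - t) * sin t" for a b t :: real
proof -
  have "(sa * ct - ca * st) * (sb * ct - cb * st)
      - (sa * sb - ((sa * cb + ca * sb) * ct - (ca * cb - sa * sb) * st) * st)
    = sa * sb * (st\<^sup>2 + ct\<^sup>2 - 1)" for sa ca sb cb st ct :: real
    by (simp add: power2_eq_square algebra_simps)
  from this[of "sin a" "cos t" "cos a" "sin t" "sin b" "cos b"] show ?thesis
    by (simp add: sin_diff sin_add cos_add)
qed

lemma sin_le_sin_between:
  assumes "0 < t" "t \<le> y" "y \<le> pi - t"
  shows "sin t \<le> sin y"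
proof (cases "y \<le> pi / 2")
  case True
  show ?thesis by (rule sin_monotone_2pi_le) (use True assms pi_gt_zero in linarith)+
next
  case False
  have "sin t \<le> sin (pi - y)"
    by (rule sin_monotone_2pi_le) (use False assms pi_gt_zero in linarith)+
  then show ?thesis by simp
qed

text \<open>The arguments below use that \<open>pi / p\<close> is smaller than a right angle.\<close>

locale Hecke_index =
  fixes p :: nat
  assumes p3: "3 \<le> p"
begin

lemma sin_pos: "sin (pi / real p) > 0"
  using p3 by (intro sin_gt_zero) (auto simp: divide_simps)

lemma cos_pos: "cos (pi / real p) > 0"
  using p3 by (intro cos_gt_zero) (auto simp: divide_simps)

lemma sr_shift: "sr p (a - 1) * sr p (b - 1) = sr p a * sr p b - sr p (a + b - 1)"
proof -
  have "sin ((a - 1) * t) * sin ((b - 1) * t) = sin (a * t) * sin (b * t) - sin ((a + b - 1) * t) * sin t"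
    for t :: real
    using sin_product_shift[of "a * t" t "b * t"] by (simp add: algebra_simps)
  moreover have "x / s * (y / s) = z / s * (w / s) - v / s"
    if "x * y = z * w - v * s" "s \<noteq> 0" for x y z w v s :: real
    using that by (simp add: field_simps)
  ultimately show ?thesis using sin_pos unfolding sr_def by (metis less_irrefl)
qed

lemma sr_0: "sr p 0 = 0" and sr_1: "sr p 1 = 1" and sr_minus: "sr p (- x) = - sr p x"
  using sin_pos by (simp_all add: sr_def)

lemma sr_add_p: "sr p (x + real p) = - sr p x"
proof -
  have "(x + real p) * (pi / real p) = x * (pi / real p) + pi" using p3 by (simp add: field_simps)
  then show ?thesis by (simp add: sr_def sin_add)
qed

lemma abs_sr_le: "\<bar>sr p x\<bar> \<le> 1 / sin (pi / real p)"
  unfolding sr_def using sin_pos by (simp add: abs_divide divide_right_mono)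

text \<open>On the interval from \<open>t\<close> to \<open>pi - t\<close> the sine is at least its value at the end points.\<close>

lemma sr_ge_1:
  assumes "1 \<le> x" "x \<le> real p - 1"
  shows "sr p x \<ge> 1"
proof -
  let ?t = "pi / real p"
  have t: "?t > 0" using p3 by simp
  have pt: "real p * ?t = pi" using p3 by simp
  have "1 * ?t \<le> x * ?t" using assms t by (intro mult_right_mono) auto
  then have lo: "?t \<le> x * ?t" by simp
  have "x * ?t \<le> (real p - 1) * ?t" using assms t by (intro mult_right_mono) auto
  then have hi: "x * ?t \<le> pi - ?t" by (simp only: left_diff_distrib pt mult_1)
  have "sin ?t \<le> sin (x * ?t)" using sin_le_sin_between[OF t lo hi] .
  then show ?thesis using sin_pos by (simp add: sr_def)
qed

lemma rot_add: "rot p j ** rot p k = rot p (j + k)"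
  using sr_shift[of j k] sr_shift[of j "k + 1"] sr_shift[of "j + 1" k] sr_shift[of "j + 1" "k + 1"]
  by (simp add: rot_def algebra_simps)

lemma rot_0: "rot p 0 = mat 1"
  by (simp add: rot_def mat22_one sr_0 sr_1 sr_minus)

lemma rot_add_p: "rot p (x + real p) = - rot p x"
  using sr_add_p[of "x - 1"] sr_add_p[of x] sr_add_p[of "x + 1"]
  by (simp add: rot_def algebra_simps)

lemma det_rot [simp]: "det (rot p k) = 1"
proof -
  have "sr p (k - 1) * sr p (- k - 1) = sr p k * sr p (- k) - sr p (k + - k - 1)"
    by (rule sr_shift)
  moreover have "sr p (- k - 1) = - sr p (k + 1)" using sr_minus[of "k + 1"] by simp
  ultimately show ?thesis using sr_minus[of k] sr_minus[of 1] sr_1 by (simp add: rot_def)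
qed

lemma psl_rot_mod: "psl (rot p (real (k mod p))) = psl (rot p (real k))"
proof (induction k rule: less_induct)
  case (less k)
  show ?case
  proof (cases "k < p")
    case False
    then have "psl (rot p (real k)) = psl (rot p (real (k - p)))"
      using rot_add_p[of "real (k - p)"] by (simp add: of_nat_diff)
    then show ?thesis using False less[of "k - p"] p3 by (simp add: le_mod_geq)
  qed simp
qed

lemma sr_2: "sr p 2 = 2 * cos (pi / real p)"
  using sin_pos sin_double[of "pi / real p"] by (simp add: sr_def)

lemma gam_rot: "gam p = psl (rot p 1)"
  by (simp add: gam_eq rot_def sr_0 sr_1 sr_2)

lemma gam_carrier: "gam p \<in> carrier (Hecke p)"
  unfolding carrier_Hecke gam_def by (intro generate.eng generate.incl) simp_all

lemma gam_pow: "gam p [^]\<^bsub>Hecke p\<^esub> k = psl (rot p (real k))"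
proof (induction k)
  case 0
  then show ?case by (simp add: Hecke_one rot_0)
next
  case (Suc k)
  then show ?case by (simp add: gam_rot rot_add add.commute)
qed

lemma rot_carrier: "psl (rot p (real k)) \<in> carrier (Hecke p)"
proof -
  interpret H: group "Hecke p" by (rule group_Hecke)
  show ?thesis using H.nat_pow_closed[OF gam_carrier, of k] by (simp add: gam_pow)
qed

lemma letter_carrier: "psl (letter p (real k)) \<in> carrier (Hecke p)"
proof -
  interpret H: group "Hecke p" by (rule group_Hecke)
  have "psl (J ** rot p (real k)) \<in> carrier (Hecke p)"
    using H.m_closed[OF iota_carrier rot_carrier[of k]] by (simp add: iota_eq)
  then show ?thesis by (simp add: J_rot)
qed

lemma det_letter [simp]: "det (letter p k) = 1"
  using det_mul[of J "rot p k"] by (simp add: J_rot det_neg2)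

lemma det_word [simp]: "det (word p ks) = 1"
  by (induction ks) (simp_all add: det_mul)

lemma word_carrier: "psl (word p ks) \<in> carrier (Hecke p)"
proof -
  interpret H: group "Hecke p" by (rule group_Hecke)
  show ?thesis
  proof (induction ks)
    case Nil
    then show ?case using H.one_closed by (simp add: Hecke_one)
  next
    case (Cons k ks)
    then show ?case using H.m_closed[OF letter_carrier[of k] Cons] by simp
  qed
qed

section \<open>The normal form\<close>

text \<open>The normal forms of a free product of cyclic groups: a power of the rotation, followed by an alternating product of
  \<open>iota\<close> and nontrivial powers of the rotation, followed by an optional \<open>iota\<close>.\<close>

definition normal_forms :: "(real^2^2) set set" where
  "normal_forms = {psl (rot p (real a) ** word p ks ** Q) | a ks Q.
     a < p \<and> set ks \<subseteq> {1..<p} \<and> Q \<in> {mat 1, J}}"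

lemma normal_formsI:
  "a < p \<Longrightarrow> set ks \<subseteq> {1..<p} \<Longrightarrow> Q \<in> {mat 1, J} \<Longrightarrow>
    psl (rot p (real a) ** word p ks ** Q) \<in> normal_forms"
  by (auto simp: normal_forms_def)

lemma normal_forms_psl:
  assumes "x \<in> normal_forms"
  obtains A where "x = psl A" "det A = 1"
  using assms unfolding normal_forms_def by (auto simp: det_mul)

text \<open>A trailing \<open>iota\<close> merges with the new power of the rotation into one more letter, or survives if that
  power is trivial.\<close>

lemma normal_forms_J_rot:
  assumes "a < p" "set ks \<subseteq> {1..<p}"
  shows "psl (rot p (real a) ** word p ks ** J ** rot p (real j)) \<in> normal_forms"
proof -
  let ?w = "rot p (real a) ** word p ks"
  let ?k = "j mod p"
  have eq: "psl (?w ** J ** rot p (real j)) = psl (?w ** J ** rot p (real ?k))"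
    by (rule psl_mult_cong) (simp_all add: psl_rot_mod)
  show ?thesis
  proof (cases "?k = 0")
    case True
    then show ?thesis using eq normal_formsI[OF assms, of J] by (simp add: rot_0)
  next
    case False
    have "psl (?w ** J ** rot p (real ?k)) = psl (?w ** (J ** rot p (real ?k)))"
      by (simp add: matrix_mul_assoc)
    also have "\<dots> = psl (?w ** letter p (real ?k))" unfolding J_rot psl_mult_neg ..
    also have "\<dots> = psl (rot p (real a) ** word p (ks @ [?k]) ** mat 1)"
      by (simp add: word_append matrix_mul_assoc)
    also have "\<dots> \<in> normal_forms"
      using False assms p3 by (intro normal_formsI) auto
    finally show ?thesis using eq by simp
  qed
qed

text \<open>If the form ends in a letter, its power of the rotation is combined with the new one, which reduces
  the claim to a form that ends in \<open>iota\<close>.\<close>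

lemma normal_forms_mult_rot:
  assumes "psl A \<in> normal_forms"
  shows "psl (A ** rot p (real j)) \<in> normal_forms"
proof -
  obtain a ks Q where nf: "psl A = psl (rot p (real a) ** word p ks ** Q)" "a < p"
      "set ks \<subseteq> {1..<p}" "Q \<in> {mat 1, J}"
    using assms by (auto simp: normal_forms_def)
  have eq: "psl (A ** rot p (real j)) = psl (rot p (real a) ** word p ks ** Q ** rot p (real j))"
    using nf(1) by (rule psl_mult_cong) simp
  consider "Q = J" | "Q = mat 1" "ks = []" | k ks' where "Q = mat 1" "ks = ks' @ [k]"
    using nf(4) by (cases ks rule: rev_cases) auto
  then have "psl (rot p (real a) ** word p ks ** Q ** rot p (real j)) \<in> normal_forms"
  proof cases
    case 1
    then show ?thesis using normal_forms_J_rot nf by simp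
  next
    case 2
    then have "rot p (real a) ** word p ks ** Q ** rot p (real j) = rot p (real (a + j))"
      by (simp add: rot_add)
    then show ?thesis using psl_rot_mod[of "a + j"] p3 normal_formsI[of "(a + j) mod p" "[]" "mat 1"]
      by simp
  next
    case 3
    have l: "letter p (real k) = - (J ** rot p (real k))" by (simp add: J_rot)
    have "psl (rot p (real a) ** word p ks ** Q ** rot p (real j))
      = psl (rot p (real a) ** word p ks' ** J ** (rot p (real k) ** rot p (real j)))"
      unfolding 3 by (simp add: word_append l matrix_mul_assoc neg_mult)
    also have "\<dots> = psl (rot p (real a) ** word p ks' ** J ** rot p (real (k + j)))"
      by (simp add: rot_add)
    also have "\<dots> \<in> normal_forms" by (rule normal_forms_J_rot) (use nf 3 in auto)
    finally show ?thesis .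
  qed
  then show ?thesis using eq by simp
qed

lemma normal_forms_mult_J:
  assumes "psl A \<in> normal_forms"
  shows "psl (A ** J) \<in> normal_forms"
proof -
  obtain a ks Q where nf: "psl A = psl (rot p (real a) ** word p ks ** Q)" "a < p"
      "set ks \<subseteq> {1..<p}" "Q \<in> {mat 1, J}"
    using assms by (auto simp: normal_forms_def)
  have eq: "psl (A ** J) = psl (rot p (real a) ** word p ks ** (Q ** J))"
    using psl_mult_cong[OF nf(1) refl, of J] by (simp add: matrix_mul_assoc)
  show ?thesis
  proof (cases "Q = J")
    case True
    then have "psl (A ** J) = psl (rot p (real a) ** word p ks ** mat 1)"
      unfolding eq by (simp add: J_J neg_mult)
    also have "\<dots> \<in> normal_forms" by (rule normal_formsI[OF nf(2,3)]) simp
    finally show ?thesis .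
  next
    case False
    then have "psl (A ** J) = psl (rot p (real a) ** word p ks ** J)"
      unfolding eq using nf(4) by simp
    also have "\<dots> \<in> normal_forms" by (rule normal_formsI[OF nf(2,3)]) simp
    finally show ?thesis .
  qed
qed

lemma one_PSL2: "\<one>\<^bsub>PSL2\<^esub> = psl (mat 1)"
  using Hecke_one[of p] by (simp add: Hecke_def)

text \<open>The normal forms contain the identity and are stable under right multiplication by the generators
  and their inverses.\<close>

lemma carrier_subset_normal_forms: "carrier (Hecke p) \<subseteq> normal_forms"
proof
  fix x assume "x \<in> carrier (Hecke p)"
  then have x: "x \<in> generate PSL2 {iota, alpha p}" by (simp add: carrier_Hecke)
  have gens: "generate PSL2 {iota, alpha p} \<subseteq> carrier PSL2"
    using generators_in_PSL2 by (intro group.generate_incl[OF group_PSL2]) auto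
  have alpha: "alpha p = psl (J ** rot p 1)"
    by (simp add: alpha_def J_rot letter_def sr_0 sr_1 sr_2 psl_eq_iff)
  have iota_inv: "inv\<^bsub>PSL2\<^esub> iota = psl J"
    by (rule group.inv_equality[OF group_PSL2])
      (use generators_in_PSL2 in \<open>auto simp: iota_eq mult_PSL2 J_J one_PSL2\<close>)
  have pred: "rot p (real (p - 1)) ** rot p 1 = - mat 1"
    using rot_add_p[of 0] p3 by (simp add: rot_add rot_0 of_nat_diff)
  have alpha_inv: "inv\<^bsub>PSL2\<^esub> (alpha p) = psl (rot p (real (p - 1)) ** J)"
  proof (rule group.inv_equality[OF group_PSL2])
    have "rot p (real (p - 1)) ** J ** (J ** rot p 1) = rot p (real (p - 1)) ** (J ** J) ** rot p 1"
      by (simp add: matrix_mul_assoc)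
    also have "\<dots> = mat 1" by (simp add: J_J neg_mult pred[simplified])
    finally show "psl (rot p (real (p - 1)) ** J) \<otimes>\<^bsub>PSL2\<^esub> alpha p = \<one>\<^bsub>PSL2\<^esub>"
      by (simp add: alpha mult_PSL2 one_PSL2)
    show "psl (rot p (real (p - 1)) ** J) \<in> carrier PSL2"
      unfolding carrier_PSL2 by (intro imageI) (simp add: det_mul)
  qed (use generators_in_PSL2 in simp)
  have "\<forall>s\<in>normal_forms. s \<otimes>\<^bsub>PSL2\<^esub> x \<in> normal_forms"
    using x
  proof (induction rule: generate.induct)
    case one
    show ?case
    proof
      fix s assume s: "s \<in> normal_forms"
      then obtain A where "s = psl A" by (rule normal_forms_psl)
      then show "s \<otimes>\<^bsub>PSL2\<^esub> \<one>\<^bsub>PSL2\<^esub> \<in> normal_forms" using s by (simp add: one_PSL2 mult_PSL2)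
    qed
  next
    case (incl h)
    show ?case
    proof
      fix s assume s: "s \<in> normal_forms"
      then obtain A where A: "s = psl A" by (rule normal_forms_psl)
      then have AJ: "psl (A ** J) \<in> normal_forms" using normal_forms_mult_J s by simp
      have "psl (A ** J ** rot p 1) \<in> normal_forms" using normal_forms_mult_rot[OF AJ, of 1] by simp
      then show "s \<otimes>\<^bsub>PSL2\<^esub> h \<in> normal_forms" using incl A AJ
        by (auto simp: iota_eq alpha mult_PSL2 matrix_mul_assoc)
    qed
  next
    case (inv h)
    show ?case
    proof
      fix s assume s: "s \<in> normal_forms"
      then obtain A where A: "s = psl A" by (rule normal_forms_psl)
      then have AJ: "psl (A ** J) \<in> normal_forms" using normal_forms_mult_J s by simp
      have "psl (A ** rot p (real (p - 1)) ** J) \<in> normal_forms"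
        using normal_forms_mult_J normal_forms_mult_rot s A by blast
      then show "s \<otimes>\<^bsub>PSL2\<^esub> inv\<^bsub>PSL2\<^esub> h \<in> normal_forms" using inv A AJ
        by (auto simp: iota_inv alpha_inv mult_PSL2 matrix_mul_assoc)
    qed
  next
    case (eng h1 h2)
    interpret P: group PSL2 by (rule group_PSL2)
    show ?case
    proof
      fix s assume s: "s \<in> normal_forms"
      then obtain A where A: "s = psl A" "det A = 1" by (rule normal_forms_psl)
      then have "s \<in> carrier PSL2" by (simp add: carrier_PSL2)
      then have "s \<otimes>\<^bsub>PSL2\<^esub> (h1 \<otimes>\<^bsub>PSL2\<^esub> h2) = s \<otimes>\<^bsub>PSL2\<^esub> h1 \<otimes>\<^bsub>PSL2\<^esub> h2"
        using eng gens by (intro P.m_assoc[symmetric]) auto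
      then show "s \<otimes>\<^bsub>PSL2\<^esub> (h1 \<otimes>\<^bsub>PSL2\<^esub> h2) \<in> normal_forms" using eng s by simp
    qed
  qed
  moreover have "psl (mat 1) \<in> normal_forms"
    using normal_formsI[of 0 "[]" "mat 1"] p3 by (simp add: rot_0)
  ultimately have "psl (mat 1) \<otimes>\<^bsub>PSL2\<^esub> x \<in> normal_forms" by blast
  moreover obtain A where "x = psl A" using x gens by (auto simp: carrier_PSL2)
  ultimately show "x \<in> normal_forms" by (simp add: mult_PSL2)
qed

lemma normal_form:
  assumes "x \<in> carrier (Hecke p)"
  obtains a ks Q where "x = psl (rot p (real a) ** word p ks ** Q)" "a < p"
    "set ks \<subseteq> {1..<p}" "Q \<in> {mat 1, J}"
  using carrier_subset_normal_forms assms unfolding normal_forms_def by blast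

section \<open>Positivity of words and discreteness\<close>

text \<open>Each letter has nonnegative entries, diagonal at least 1, and off-diagonal sum at least 1. The
  last point depends on \<open>p \<ge> 3\<close>, which makes one of the neighbouring values \<open>sr p (k - 1)\<close> and \<open>sr p (k + 1)\<close> fall into
  the range of \<open>sr_ge_1\<close>. Multiplying by such a matrix keeps the entries from decreasing and raises
  their sum by at least 1.\<close>

lemma word_large:
  assumes "set ks \<subseteq> {1..<p}"
  obtains a b c d where "word p ks = mat22 a b c d" "1 \<le> a" "1 \<le> d" "0 \<le> b" "0 \<le> c"
    "real (length ks) + 2 \<le> a + b + c + d"
proof -
  have "\<exists>a b c d. word p ks = mat22 a b c d \<and> 1 \<le> a \<and> 1 \<le> d \<and> 0 \<le> b \<and> 0 \<le> c \<and>
    real (length ks) + 2 \<le> a + b + c + d"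
    using assms
  proof (induction ks)
    case Nil
    then show ?case by (auto simp: mat22_one)
  next
    case (Cons k ks)
    then obtain a b c d where w: "word p ks = mat22 a b c d" "1 \<le> a" "1 \<le> d" "0 \<le> b" "0 \<le> c"
      "real (length ks) + 2 \<le> a + b + c + d" by auto
    have k: "1 \<le> k" "k < p" using Cons by auto
    define x y z where "x = sr p (real k)" "y = sr p (real k + 1)" "z = sr p (real k - 1)"
    have x: "1 \<le> x" unfolding x_y_z_def using k by (intro sr_ge_1) auto
    have y: "0 \<le> y" "k + 1 < p \<Longrightarrow> 1 \<le> y"
    proof -
      show y1: "1 \<le> y" if "k + 1 < p" unfolding x_y_z_def using that by (intro sr_ge_1) auto
      show "0 \<le> y"
      proof (cases "k + 1 < p")
        case False
        then have "real k + 1 = 0 + real p" using k by simp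
        then show ?thesis using sr_add_p[of 0] sr_0 unfolding x_y_z_def by simp
      qed (use y1 in auto)
    qed
    have z: "0 \<le> z" "2 \<le> k \<Longrightarrow> 1 \<le> z"
    proof -
      show z1: "1 \<le> z" if "2 \<le> k" unfolding x_y_z_def using that k by (intro sr_ge_1) auto
      show "0 \<le> z"
      proof (cases "2 \<le> k")
        case False
        then have "real k - 1 = 0" using k by simp
        then show ?thesis using sr_0 unfolding x_y_z_def by simp
      qed (use z1 in auto)
    qed
    have "k + 1 < p \<or> 2 \<le> k" using p3 by linarith
    then have yz: "1 \<le> y + z" using y z by auto
    have e: "word p (k # ks) = mat22 (x * a + y * c) (x * b + y * d) (z * a + x * c) (z * b + x * d)"
      using w(1) by (simp add: letter_def x_y_z_def)
    have le: "u \<le> x * u" if "0 \<le> u" for u using mult_right_mono[OF x that] by simp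
    have "z \<le> z * a" "y \<le> y * d"
      using mult_left_mono[OF w(2) z(1)] mult_left_mono[OF w(3) y(1)] by simp_all
    moreover have "0 \<le> y * c" "0 \<le> z * b" using y z w by simp_all
    moreover have "a \<le> x * a" "b \<le> x * b" "c \<le> x * c" "d \<le> x * d"
      by (rule le, use w in simp)+
    moreover have "0 \<le> y * d" "0 \<le> z * a" using y z w by simp_all
    moreover have "real (length (k # ks)) = real (length ks) + 1" by simp
    ultimately have "1 \<le> x * a + y * c" "1 \<le> z * b + x * d" "0 \<le> x * b + y * d" "0 \<le> z * a + x * c"
      "real (length (k # ks)) + 2
        \<le> (x * a + y * c) + (x * b + y * d) + (z * a + x * c) + (z * b + x * d)"
      using w(2-6) y(1) z(1) yz by linarith+
    then show ?case using e by blast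
  qed
  then show ?thesis using that by blast
qed

lemma word_trace:
  assumes "set ks \<subseteq> {1..<p}"
  shows "trace (word p ks) \<ge> 2"
  by (rule word_large[OF assms]) simp

text \<open>Discreteness. Stripping the rotation and the trailing \<open>iota\<close> from a normal form changes the entries by
  a bounded factor, so bounded entries bound the entries of the word and thereby its length.\<close>

lemma finite_entry_bounded:
  "finite {z \<in> carrier (Hecke p). \<exists>M\<in>z. entry_bounded B M}"
proof -
  define K where "K = 1 / sin (pi / real p)"
  \<comment> \<open>Each of the four entries of the word is a sum of two products bounded by \<open>K B\<close>.\<close>
  define N where "N = nat \<lceil>8 * K * B\<rceil>"
  let ?F = "{ks. set ks \<subseteq> {1..<p} \<and> length ks \<le> N}"
  have "finite ?F" by (rule finite_lists_length_le) simp
  then have "finite ((\<lambda>(a, ks, Q). psl (rot p (real a) ** word p ks ** Q)) ` ({..<p} \<times> ?F \<times> {mat 1, J}))"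
    by simp
  moreover have "{z \<in> carrier (Hecke p). \<exists>M\<in>z. entry_bounded B M}
    \<subseteq> (\<lambda>(a, ks, Q). psl (rot p (real a) ** word p ks ** Q)) ` ({..<p} \<times> ?F \<times> {mat 1, J})"
  proof
    fix x assume "x \<in> {z \<in> carrier (Hecke p). \<exists>M\<in>z. entry_bounded B M}"
    then obtain M where x: "x \<in> carrier (Hecke p)" and M: "M \<in> x" "entry_bounded B M" by blast
    obtain a ks Q where nf: "x = psl (rot p (real a) ** word p ks ** Q)" "a < p"
      "set ks \<subseteq> {1..<p}" "Q \<in> {mat 1, J}" by (rule normal_form[OF x])
    let ?G = "rot p (real a)"
    have dQ: "det Q = 1" using nf(4) by auto
    have "M = ?G ** word p ks ** Q \<or> M = - (?G ** word p ks ** Q)" using M nf by (auto simp: psl_def)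
    then obtain M' where M': "M' = ?G ** word p ks ** Q" "entry_bounded B M'"
      using M(2) by (auto simp: entry_bounded_def)
    \<comment> \<open>The word is recovered from the element by the inverses of the outer factors.\<close>
    have GG: "rot p (- real a) ** ?G = mat 1" by (simp add: rot_add rot_0)
    have "rot p (- real a) ** M' ** adj Q
      = (rot p (- real a) ** ?G) ** word p ks ** (Q ** adj Q)"
      unfolding M' by (simp only: matrix_mul_assoc)
    then have w: "word p ks = rot p (- real a) ** M' ** adj Q"
      using GG adj_mult[OF dQ] by simp
    obtain m1 m2 m3 m4 where m: "M' = mat22 m1 m2 m3 m4" by (rule mat22_cases)
    obtain g1 g2 g3 g4 where g: "rot p (- real a) = mat22 g1 g2 g3 g4" by (rule mat22_cases)
    have mB: "\<bar>m1\<bar> \<le> B" "\<bar>m2\<bar> \<le> B" "\<bar>m3\<bar> \<le> B" "\<bar>m4\<bar> \<le> B" using M'(2) unfolding m by auto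
    have gK: "\<bar>g1\<bar> \<le> K" "\<bar>g2\<bar> \<le> K" "\<bar>g3\<bar> \<le> K" "\<bar>g4\<bar> \<le> K"
      using g abs_sr_le unfolding K_def by (auto simp: rot_def)
    have bound: "u * v \<le> K * B" "- (u * v) \<le> K * B" if "\<bar>u\<bar> \<le> K" "\<bar>v\<bar> \<le> B" for u v
    proof -
      have "\<bar>u * v\<bar> \<le> K * B" unfolding abs_mult using that by (intro mult_mono) auto
      then show "u * v \<le> K * B" "- (u * v) \<le> K * B" by linarith+
    qed
    note bounds = bound[OF gK(1) mB(1)] bound[OF gK(2) mB(3)] bound[OF gK(1) mB(2)]
      bound[OF gK(2) mB(4)] bound[OF gK(3) mB(1)] bound[OF gK(4) mB(3)] bound[OF gK(3) mB(2)]
      bound[OF gK(4) mB(4)]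
    obtain a' b c d where W: "word p ks = mat22 a' b c d" "real (length ks) + 2 \<le> a' + b + c + d"
      using word_large[OF nf(3)] by metis
    have "a' + b + c + d \<le> 8 * (K * B)"
    proof (cases "Q = J")
      case True
      then show ?thesis using W(1) bounds unfolding w g m by (simp add: J_def)
    next
      case False
      then have "adj Q = mat 1" using nf(4) by (simp add: mat22_one)
      then show ?thesis using W(1) bounds unfolding w g m by simp
    qed
    then have "real (length ks) \<le> 8 * K * B" using W(2) by simp
    then have "length ks \<le> N" unfolding N_def by linarith
    then show "x \<in> (\<lambda>(a, ks, Q). psl (rot p (real a) ** word p ks ** Q)) ` ({..<p} \<times> ?F \<times> {mat 1, J})"
      using nf by (intro image_eqI[of _ _ "(a, ks, Q)"]) auto
  qed
  ultimately show ?thesis by (rule rev_finite_subset)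
qed

section \<open>Involutions\<close>

lemma conjugate_psl:
  assumes "psl A \<in> carrier (Hecke p)" "det A = 1"
  shows "conjugate (Hecke p) (psl B) (psl (A ** B ** adj A))"
  unfolding conjugate_def using assms by (intro bexI[of _ "psl A"]) (simp_all add: Hecke_inv)

text \<open>Cyclic rotation of a product is a conjugation.\<close>

lemma conjugate_swap:
  assumes "psl A \<in> carrier (Hecke p)" "det A = 1"
  shows "conjugate (Hecke p) (psl (A ** B)) (psl (B ** A))"
proof -
  have "psl (adj A) \<in> carrier (Hecke p)"
    using group.inv_closed[OF group_Hecke assms(1)] Hecke_inv[OF assms] by simp
  moreover have "adj A ** (A ** B) ** adj (adj A) = (adj A ** A) ** B ** A"
    by (simp add: matrix_mul_assoc adj_adj)
  ultimately show ?thesis using conjugate_psl[of "adj A" "A ** B"] adj_mult[OF assms(2)] assms(2) by simp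
qed

lemma conjugate_refl:
  assumes "x \<in> carrier (Hecke p)"
  shows "conjugate (Hecke p) x x"
proof -
  interpret H: group "Hecke p" by (rule group_Hecke)
  show ?thesis unfolding conjugate_def using assms by (intro bexI[of _ "\<one>\<^bsub>Hecke p\<^esub>"]) auto
qed

text \<open>The trace of the \<open>k\<close>-th power of the rotation is twice the cosine of \<open>k pi / p\<close>.\<close>

lemma trace_rot_zero:
  assumes "k < p" "trace (rot p (real k)) = 0"
  shows "p = 2 * k"
proof -
  let ?t = "pi / real p"
  have "sr p (real k + 1) = sr p (real k - 1)" using assms(2) by (simp add: rot_def)
  then have "sin ((real k + 1) * ?t) = sin ((real k - 1) * ?t)" using sin_pos by (simp add: sr_def)
  moreover have "sin ((x + 1) * t) - sin ((x - 1) * t) = 2 * (cos (x * t) * sin t)" for x t :: real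
    by (simp add: distrib_right left_diff_distrib sin_add sin_diff)
  ultimately have "cos (real k * ?t) * sin ?t = 0"
    by (metis cancel_comm_monoid_add_class.diff_cancel mult_eq_0_iff zero_neq_numeral)
  then have "cos (real k * ?t) = cos (pi / 2)" using sin_pos by simp
  moreover have "real k * ?t \<le> pi" "0 \<le> real k * ?t" using assms p3 by (simp_all add: field_simps)
  ultimately have "real k * ?t = pi / 2" using cos_inj_pi[of "real k * ?t" "pi / 2"] by simp
  then have "2 * real k = real p" using p3 by (simp add: field_simps)
  then show ?thesis by linarith
qed

text \<open>Cyclic reduction. Moving the initial rotation to the end (or an initial \<open>iota\<close> when the form also ends
  in \<open>iota\<close>) shortens the word or turns the element into a nonempty word. The latter has trace at least
  2 and is no involution, so the reduction ends at \<open>iota\<close> or at a power of the rotation.\<close>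

lemma involution_normal_form:
  assumes "a < p" "set ks \<subseteq> {1..<p}" "Q \<in> {mat 1, J}"
    and "trace (rot p (real a) ** word p ks ** Q) = 0"
  shows "conjugate (Hecke p) (psl (rot p (real a) ** word p ks ** Q)) iota \<or>
    (\<exists>k. p = 2 * k \<and> conjugate (Hecke p) (psl (rot p (real a) ** word p ks ** Q)) (psl (rot p (real k))))"
  using assms
proof (induction "length ks" arbitrary: a ks Q rule: less_induct)
  case less
  let ?G = "rot p (real a)"
  let ?P = "\<lambda>x. conjugate (Hecke p) x iota \<or> (\<exists>k. p = 2 * k \<and> conjugate (Hecke p) x (psl (rot p (real k))))"
  have step: "?P (psl A)" if "psl A \<in> carrier (Hecke p)" "conjugate (Hecke p) (psl A) (psl B)" "?P (psl B)" for A B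
    using group.conjugate_trans[OF group_Hecke that(2) _ that(1)] that(3) by blast
  have car: "psl (?G ** word p ks ** Q) \<in> carrier (Hecke p)"
  proof -
    interpret H: group "Hecke p" by (rule group_Hecke)
    have "psl Q \<in> carrier (Hecke p)"
      using less.prems(3) iota_carrier[of p] H.one_closed by (auto simp: iota_eq Hecke_one)
    from H.m_closed[OF H.m_closed[OF rot_carrier[of a] word_carrier[of ks]] this]
    show ?thesis by simp
  qed
  have no_word: False if "psl (word p ls) = psl A" "set ls \<subseteq> {1..<p}" "trace A = 0" for ls A
    using word_trace[OF that(2)] psl_trace_zero[OF that(1)] that(3) by simp
  consider (rot) "Q = mat 1" "ks = []" | (shift) k ks' where "Q = mat 1" "ks = ks' @ [k]"
    | (J) "Q = J" "a = 0" "ks = []" | (turn) k ks' where "Q = J" "a = 0" "ks = k # ks'"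
    | (word) "Q = J" "a \<noteq> 0"
  proof -
    have "ks = [] \<or> (\<exists>k ks'. ks = ks' @ [k])" by (cases ks rule: rev_cases) auto
    moreover have "ks = [] \<or> (\<exists>k ks'. ks = k # ks')" by (cases ks) auto
    moreover have "Q = mat 1 \<or> Q = J" using less.prems(3) by simp
    ultimately show thesis using that by blast
  qed
  then show ?case
  proof cases
    case rot
    then show ?thesis using trace_rot_zero[of a] less.prems conjugate_refl[OF rot_carrier[of a]] by auto
  next
    case shift
    let ?j = "(k + a) mod p"
    have l: "letter p (real k) = - (J ** rot p (real k))" by (simp add: J_rot)
    have "psl (word p ks ** ?G) = psl (word p ks' ** J ** (rot p (real k) ** ?G))"
      unfolding shift by (simp add: word_append l matrix_mul_assoc neg_mult)
    also have "\<dots> = psl (word p ks' ** J ** rot p (real (k + a)))" by (simp add: rot_add)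
    also have "\<dots> = psl (word p ks' ** J ** rot p (real ?j))"
      by (rule psl_mult_cong) (simp_all only: psl_rot_mod)
    finally have eq: "psl (word p ks ** ?G) = psl (word p ks' ** J ** rot p (real ?j))" .
    have tr: "trace (word p ks ** ?G) = 0"
      using less.prems(4) shift trace_mul_sym[of "word p ks" ?G] by simp
    \<comment> \<open>Otherwise the two rotations combine to a letter, and the whole element is a nonempty word.\<close>
    have "?j = 0"
    proof (rule ccontr)
      assume j: "?j \<noteq> 0"
      have "psl (word p ks' ** J ** rot p (real ?j)) = psl (word p ks' ** (J ** rot p (real ?j)))"
        by (simp add: matrix_mul_assoc)
      also have "\<dots> = psl (word p (ks' @ [?j]))" unfolding J_rot psl_mult_neg by (simp add: word_append)
      finally show False
        using no_word[of "ks' @ [?j]" "word p ks ** ?G"] eq tr j less.prems(2) shift p3 by auto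
    qed
    then have eq: "psl (word p ks ** ?G) = psl (rot p (real 0) ** word p ks' ** J)"
      using eq by (simp add: rot_0)
    have "?P (psl (rot p (real 0) ** word p ks' ** J))"
      by (rule less.hyps) (use shift less.prems p3 psl_trace_zero[OF eq] tr in auto)
    then have "?P (psl (word p ks ** ?G))" by (simp only: eq)
    moreover have "conjugate (Hecke p) (psl (?G ** word p ks ** Q)) (psl (word p ks ** ?G))"
      using conjugate_swap[OF rot_carrier, of a "word p ks"] shift(1) by simp
    ultimately show ?thesis using step[OF car] by blast
  next
    case J
    then show ?thesis using conjugate_refl[OF iota_carrier] by (simp add: rot_0 iota_eq)
  next
    case turn
    have k: "k < p" "set ks' \<subseteq> {1..<p}" using less.prems turn by auto
    have l: "letter p (real k) = - (J ** rot p (real k))" by (simp add: J_rot)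
    let ?v = "rot p (real k) ** word p ks'"
    have eq: "psl (?G ** word p ks ** Q) = psl (J ** (?v ** J))"
      unfolding turn by (simp add: rot_0 l matrix_mul_assoc neg_mult)
    have eq': "?v ** J ** J = - (?v ** mat 1)"
      unfolding matrix_mul_assoc[symmetric] J_J by (simp add: neg_mult matrix_mul_assoc)
    have "trace (J ** (?v ** J)) = 0" using psl_trace_zero[OF eq] less.prems(4) by simp
    then have "trace (?v ** J ** J) = 0" using trace_mul_sym[of J "?v ** J"] by simp
    then have "trace (?v ** mat 1) = 0" unfolding eq' by simp
    then have "?P (psl (?v ** mat 1))"
      by (intro less.hyps) (use turn k in auto)
    moreover have "conjugate (Hecke p) (psl (?G ** word p ks ** Q)) (psl (?v ** mat 1))"
      using conjugate_swap[OF iota_carrier[unfolded iota_eq] det_J, of "?v ** J"] unfolding eq eq' by simp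
    ultimately show ?thesis using step[OF car] by blast
  next
    case word
    have "psl (word p (ks @ [a])) = psl (word p ks ** J ** ?G)"
      using psl_mult_neg(1)[of "word p ks" "letter p (real a)"]
      by (simp add: word_append J_rot matrix_mul_assoc[symmetric])
    moreover have "trace (word p ks ** J ** ?G) = 0"
      using less.prems(4) word trace_mul_sym[of "word p ks ** J" ?G] by (simp add: matrix_mul_assoc)
    ultimately show ?thesis using no_word less.prems word p3 by fastforce
  qed
qed

text \<open>Trace zero characterizes the involutions of PSL(2,R); the two alternatives are the factors of the free
  product of \<open>iota\<close> and \<open>gam p\<close>.\<close>

lemma involution_conjugate:
  assumes "psl A \<in> carrier (Hecke p)" "trace A = 0"
  shows "conjugate (Hecke p) (psl A) iota \<or>
    (\<exists>k. p = 2 * k \<and> conjugate (Hecke p) (psl A) (psl (rot p (real k))))"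
proof -
  obtain a ks Q where nf: "psl A = psl (rot p (real a) ** word p ks ** Q)" "a < p"
    "set ks \<subseteq> {1..<p}" "Q \<in> {mat 1, J}" by (rule normal_form[OF assms(1)])
  show ?thesis unfolding nf(1)
    by (rule involution_normal_form) (use nf psl_trace_zero[OF nf(1)] assms in auto)
qed

section \<open>Centralizers of the involutions\<close>

text \<open>For determinant 1 these are the Euclidean rotations, the stabilizer of the point i of the upper
  half-plane.\<close>

definition rotation_shape :: "real^2^2 \<Rightarrow> bool" where
  "rotation_shape A \<longleftrightarrow> A$1$1 = A$2$2 \<and> A$1$2 = - A$2$1"

lemma rotation_shape_mat22 [simp]: "rotation_shape (mat22 a b c d) \<longleftrightarrow> a = d \<and> b = - c"
  by (simp add: rotation_shape_def)

lemma rotation_shape_mult: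
  "rotation_shape A \<Longrightarrow> rotation_shape B \<Longrightarrow> rotation_shape (A ** B)"
  by (cases A rule: mat22_cases, cases B rule: mat22_cases) simp

lemma rotation_shape_uminus [simp]: "rotation_shape (- A) \<longleftrightarrow> rotation_shape A"
  by (cases A rule: mat22_cases) auto

lemma rotation_shape_J [simp]: "rotation_shape J" by (simp add: J_def)

text \<open>A rotation with nonnegative off-diagonal entries is diagonal, and a word with diagonal 1 and zero
  off-diagonal entries has entry sum 2, the value of the empty word only.\<close>

lemma word_rotation_shape:
  assumes "set ks \<subseteq> {1..<p}" "rotation_shape (word p ks)"
  shows "ks = []"
proof -
  obtain a b c d where w: "word p ks = mat22 a b c d" "1 \<le> a" "1 \<le> d" "0 \<le> b" "0 \<le> c"
    "real (length ks) + 2 \<le> a + b + c + d" by (rule word_large[OF assms(1)])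
  have bc: "a = d" "b = 0" "c = 0" using assms(2) w by auto
  then have "a * a = 1" using det_word[of ks] w(1) by simp
  then have "a = 1" using w(2) by (metis less_1_mult less_eq_real_def less_irrefl)
  then show ?thesis using w(6) bc by simp
qed

text \<open>The centralizer of \<open>iota\<close> consists of the rotations in the group. Up to a factor \<open>iota\<close> on either side
  such an element is a word, and that word must be empty.\<close>

lemma centralizer_iota: "centralizer (Hecke p) iota = {psl (mat 1), iota}"
proof (intro equalityI subsetI)
  fix x assume x: "x \<in> centralizer (Hecke p) iota"
  then have xc: "x \<in> carrier (Hecke p)" by (simp add: centralizer_def)
  obtain a ks Q where nf: "x = psl (rot p (real a) ** word p ks ** Q)" "a < p"
    "set ks \<subseteq> {1..<p}" "Q \<in> {mat 1, J}" by (rule normal_form[OF xc])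
  let ?C = "rot p (real a) ** word p ks ** Q"
  have dC: "det ?C = 1" using nf(4) by (auto simp: det_mul)
  have "psl (?C ** J) = psl (J ** ?C)" using x nf(1) by (simp add: centralizer_def iota_eq)
  then have "rotation_shape ?C"
  proof -
    obtain u v w z where C: "?C = mat22 u v w z" by (rule mat22_cases)
    assume "psl (?C ** J) = psl (J ** ?C)"
    then consider "v = - w" "u = z" | "v = w" "u = - z"
      unfolding C by (auto simp: psl_eq_iff J_def)
    then show ?thesis
    proof cases
      case 2
      then have "- (z * z) - w * w = 1" using dC unfolding C by simp
      moreover have "0 \<le> z * z" "0 \<le> w * w" by simp_all
      ultimately show ?thesis by linarith
    qed (simp add: C)
  qed
  then have r: "rotation_shape (rot p (real a) ** word p ks)"
  proof (cases "Q = J")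
    case True
    assume "rotation_shape ?C"
    then have "rotation_shape (?C ** J)" by (rule rotation_shape_mult[OF _ rotation_shape_J])
    moreover have "?C ** J = - (rot p (real a) ** word p ks)"
      unfolding True matrix_mul_assoc[symmetric] J_J by (simp add: neg_mult matrix_mul_assoc)
    ultimately show ?thesis by simp
  qed (use nf(4) in simp)
  show "x \<in> {psl (mat 1), iota}"
  proof (cases "a = 0")
    case True
    then have "ks = []" using r word_rotation_shape nf(3) by (simp add: rot_0)
    then show ?thesis using nf True by (auto simp: rot_0 iota_eq)
  next
    case False
    \<comment> \<open>A nontrivial initial rotation would make \<open>iota\<close> times the element a nonempty word.\<close>
    have "J ** (rot p (real a) ** word p ks) = - word p (a # ks)"
      by (simp add: matrix_mul_assoc J_rot neg_mult)
    then have "rotation_shape (word p (a # ks))"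
      using rotation_shape_mult[OF rotation_shape_J r] by simp
    moreover have "set (a # ks) \<subseteq> {1..<p}" using nf False by auto
    ultimately show ?thesis using word_rotation_shape by blast
  qed
next
  interpret H: group "Hecke p" by (rule group_Hecke)
  have "psl (mat 1) \<in> carrier (Hecke p)" using H.one_closed by (simp add: Hecke_one)
  moreover fix x assume "x \<in> {psl (mat 1), iota}"
  ultimately show "x \<in> centralizer (Hecke p) iota"
    using iota_carrier[of p] by (auto simp: centralizer_def iota_eq)
qed

lemma card_centralizer_iota: "card (centralizer (Hecke p) iota) = 2"
proof -
  have "psl (mat 1) \<noteq> iota" by (simp add: iota_eq psl_eq_iff J_def mat22_one)
  then show ?thesis by (simp add: centralizer_iota)
qed

text \<open>For \<open>p = 2 m\<close> the angle \<open>m pi / p\<close> is a right angle.\<close>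

lemma rot_half:
  assumes "p = 2 * m"
  shows "sr p (real m) = 1 / sin (pi / real p)"
    "sr p (real m + 1) = cos (pi / real p) / sin (pi / real p)"
    "sr p (real m - 1) = cos (pi / real p) / sin (pi / real p)"
    "rot p (real m) = mat22 (- (cos (pi / real p) / sin (pi / real p))) (- (1 / sin (pi / real p)))
        (1 / sin (pi / real p)) (cos (pi / real p) / sin (pi / real p))"
proof -
  let ?t = "pi / real p"
  have h: "real m * ?t = pi / 2" using assms p3 by (simp add: field_simps)
  show 1: "sr p (real m) = 1 / sin ?t" unfolding sr_def h by simp
  show 2: "sr p (real m + 1) = cos ?t / sin ?t"
    unfolding sr_def distrib_right h by (simp add: sin_add)
  show 3: "sr p (real m - 1) = cos ?t / sin ?t"
    unfolding sr_def left_diff_distrib h by (simp add: sin_diff)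
  show "rot p (real m) = mat22 (- (cos ?t / sin ?t)) (- (1 / sin ?t)) (1 / sin ?t) (cos ?t / sin ?t)"
    unfolding rot_def 1 2 3 by simp
qed

text \<open>Commuting with the elliptic involution means fixing its fixed point in the upper half-plane. An
  element that anticommutes with it would turn the determinant into minus a positive semidefinite
  quadratic form.\<close>

lemma psl_commute_rot_half:
  assumes "p = 2 * m" "det A = 1" "psl (A ** rot p (real m)) = psl (rot p (real m) ** A)"
  shows "A$1$2 = - A$2$1 \<and> A$2$2 = A$1$1 + 2 * cos (pi / real p) * A$2$1"
proof -
  obtain x y z w where A: "A = mat22 x y z w" by (rule mat22_cases)
  define c s where "c = cos (pi / real p)" "s = sin (pi / real p)"
  have s: "s > 0" using sin_pos by (simp add: c_s_def)
  have c: "c * c \<le> 1" using abs_cos_le_one[of "pi / real p"] by (simp add: c_s_def abs_square_le_1 power2_eq_square[symmetric])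
  have N: "rot p (real m) = mat22 (- (c / s)) (- (1 / s)) (1 / s) (c / s)"
    using rot_half(4)[OF assms(1)] by (simp add: c_s_def)
  have d: "x * w - y * z = 1" using assms(2) A by simp
  from assms(3) consider "A ** rot p (real m) = rot p (real m) ** A"
    | "A ** rot p (real m) = - (rot p (real m) ** A)" by (auto simp: psl_eq_iff)
  then show ?thesis
  proof cases
    case 1
    then have "y = - z" "w = x + 2 * c * z" unfolding A N using s by (auto simp: field_simps)
    then show ?thesis by (simp add: A c_s_def)
  next
    case 2
    then have "(y - x * c) / s = (x * c + z) / s" "(- x + y * c) / s = (c * y + w) / s"
      unfolding A N by (simp_all add: diff_divide_distrib add_divide_distrib algebra_simps)
    then have "y - x * c = x * c + z" "- x + y * c = c * y + w"
      using s by simp_all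
    then have "w = - x" "y = z + 2 * x * c" by (auto simp: algebra_simps)
    then have "- (x * x) - z * z - 2 * x * c * z = 1" using d by (simp add: algebra_simps)
    moreover have "(x + c * z) * (x + c * z) + (1 - c * c) * (z * z) = x * x + z * z + 2 * x * c * z"
      by (simp add: algebra_simps)
    moreover have "0 \<le> (x + c * z) * (x + c * z)" "0 \<le> (1 - c * c) * (z * z)" using c by simp_all
    ultimately have False by linarith
    then show ?thesis ..
  qed
qed

text \<open>After splitting off the initial rotation, which commutes with the involution, there remains a word
  with an optional trailing \<open>iota\<close>. Commutation is a pair of linear equations on its entries, and
  their signs leave only the identity.\<close>

lemma centralizer_rot_half:
  assumes m: "p = 2 * m"
  shows "centralizer (Hecke p) (psl (rot p (real m))) = (\<lambda>a. psl (rot p (real a))) ` {..<p}"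
proof (intro equalityI subsetI)
  fix x assume x: "x \<in> centralizer (Hecke p) (psl (rot p (real m)))"
  then have xc: "x \<in> carrier (Hecke p)" by (simp add: centralizer_def)
  obtain a ks Q where nf: "x = psl (rot p (real a) ** word p ks ** Q)" "a < p"
    "set ks \<subseteq> {1..<p}" "Q \<in> {mat 1, J}" by (rule normal_form[OF xc])
  let ?C = "rot p (real a) ** word p ks ** Q"
  let ?N = "rot p (real m)" and ?R = "rot p (- real a)"
  have "psl (?C ** ?N) = psl (?N ** ?C)" using x nf(1) by (simp add: centralizer_def)
  then have comm: "psl (?R ** (?C ** ?N)) = psl (?R ** (?N ** ?C))" by (rule psl_mult_cong[OF refl])
  have R: "?R ** rot p (real a) = mat 1" "?R ** ?N = ?N ** ?R"
    by (simp_all add: rot_add rot_0 add.commute)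
  have D: "?R ** ?C = word p ks ** Q" using R(1) by (simp add: matrix_mul_assoc)
  have "?R ** (?C ** ?N) = (?R ** ?C) ** ?N" "?R ** (?N ** ?C) = ?N ** (?R ** ?C)"
    using R(2) by (simp_all add: matrix_mul_assoc)
  then have "psl (word p ks ** Q ** ?N) = psl (?N ** (word p ks ** Q))" using comm D by simp
  moreover have "det (word p ks ** Q) = 1" using nf(4) by (auto simp: det_mul)
  ultimately have shape: "(word p ks ** Q)$1$2 = - (word p ks ** Q)$2$1"
     "(word p ks ** Q)$2$2 = (word p ks ** Q)$1$1 + 2 * cos (pi / real p) * (word p ks ** Q)$2$1"
    using psl_commute_rot_half[OF m] by blast+
  obtain a' b c d where w: "word p ks = mat22 a' b c d" "1 \<le> a'" "1 \<le> d" "0 \<le> b" "0 \<le> c"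
    "real (length ks) + 2 \<le> a' + b + c + d" by (rule word_large[OF nf(3)])
  show "x \<in> (\<lambda>a. psl (rot p (real a))) ` {..<p}"
  proof (cases "Q = J")
    case True
    have "d = a'" "- c = b + 2 * cos (pi / real p) * d"
      using shape unfolding True w(1) J_def by simp_all
    moreover have "0 < 2 * cos (pi / real p) * d" using cos_pos w by simp
    ultimately show ?thesis using w by linarith
  next
    case False
    then have Q: "Q = mat 1" using nf(4) by simp
    have "b = - c" "d = a' + 2 * cos (pi / real p) * c" using shape unfolding Q w(1) by simp_all
    then have "rotation_shape (word p ks)" using w by simp
    then have "ks = []" using word_rotation_shape nf(3) by blast
    then show ?thesis using nf Q by auto
  qed
next
  fix x assume "x \<in> (\<lambda>a. psl (rot p (real a))) ` {..<p}"
  then show "x \<in> centralizer (Hecke p) (psl (rot p (real m)))"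
    using rot_carrier by (auto simp: centralizer_def rot_add add.commute)
qed

lemma inj_on_psl_rot: "inj_on (\<lambda>a. psl (rot p (real a))) {..<p}"
proof (rule linorder_inj_onI)
  fix a b assume ab: "a < b" "a \<in> {..<p}" "b \<in> {..<p}"
  show "psl (rot p (real a)) \<noteq> psl (rot p (real b))"
  proof
    assume "psl (rot p (real a)) = psl (rot p (real b))"
    then have "psl (rot p (- real a) ** rot p (real a)) = psl (rot p (- real a) ** rot p (real b))"
      by (rule psl_mult_cong[OF refl])
    then have "psl (mat 1) = psl (rot p (real b - real a))" by (simp add: rot_add rot_0)
    then have "sr p (real b - real a) = 0" by (auto simp: psl_eq_iff mat22_one rot_def)
    moreover have "1 \<le> sr p (real b - real a)" using ab by (intro sr_ge_1) auto
    ultimately show False by simp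
  qed
qed auto

lemma card_centralizer_rot_half:
  assumes "p = 2 * m"
  shows "card (centralizer (Hecke p) (psl (rot p (real m)))) = p"
  unfolding centralizer_rot_half[OF assms] card_image[OF inj_on_psl_rot] by (rule card_lessThan)

section \<open>Hyperbolic elements fixing the point -1\<close>

text \<open>In the basis of the vectors (-1, 1) and (1, 1), which represent the points -1 and 1 of the boundary,
  this is the upper triangular matrix with diagonal \<open>u\<close>, \<open>v\<close> and corner entry \<open>k\<close>.\<close>

definition minus_one_fixer :: "real \<Rightarrow> real \<Rightarrow> real \<Rightarrow> real^2^2" where
  "minus_one_fixer u v k = mat22 ((v - k + u) / 2) ((v - k - u) / 2) ((v + k - u) / 2) ((v + k + u) / 2)"

lemma psl_minus_one_fixer_inj:
  assumes "u \<noteq> 0" "psl (minus_one_fixer u v x) = psl (minus_one_fixer u v y)"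
  shows "x = y"
proof -
  from assms(2) consider "minus_one_fixer u v x = minus_one_fixer u v y"
    | "minus_one_fixer u v x = - minus_one_fixer u v y" by (auto simp: psl_eq_iff)
  then show ?thesis
  proof cases
    case 2
    then have "(v - x + u) / 2 = - ((v - y + u) / 2)" "(v - x - u) / 2 = - ((v - y - u) / 2)"
      unfolding minus_one_fixer_def mat22_uminus mat22_eq_iff by blast+
    moreover have "a / 2 = - (b / 2) \<Longrightarrow> a + b = 0" for a b :: real by simp
    ultimately have "v - x + u + (v - y + u) = 0" "v - x - u + (v - y - u) = 0" by blast+
    then have "u = 0" by linarith
    then show ?thesis using assms(1) by simp
  qed (auto simp: minus_one_fixer_def)
qed

text \<open>The element \<open>iota gam^m\<close> is hyperbolic with fixed points -1 and 1, so conjugation by it is diagonal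
  in the basis above and scales the corner entry.\<close>

lemma minus_one_fixer_conj:
  assumes "p = 2 * m"
  shows "letter p (real m) ** minus_one_fixer u v k ** adj (letter p (real m))
    = minus_one_fixer u v ((1 - cos (pi / real p)) / (1 + cos (pi / real p)) * k)"
proof -
  define c s where "c = cos (pi / real p)" "s = sin (pi / real p)"
  have s: "s > 0" "c > 0" using sin_pos cos_pos by (simp_all add: c_s_def)
  have sc: "s * s = (1 - c) * (1 + c)"
    using sin_cos_squared_add[of "pi / real p"] by (simp add: c_s_def power2_eq_square algebra_simps)
  then have c1: "1 - c \<noteq> 0" using s by auto
  have L: "letter p (real m) = mat22 (1 / s) (c / s) (c / s) (1 / s)"
    using rot_half[OF assms] by (simp add: letter_def c_s_def)
  define q where "q = (1 - c) / (1 + c)"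
  have q: "q * (1 + c) = 1 - c" using s by (simp add: q_def)
  have prod: "mat22 (1 / s) (c / s) (c / s) (1 / s) ** mat22 x y z w ** mat22 (1 / s) (- (c / s)) (- (c / s)) (1 / s)
    = mat22 ((x + c * z - c * y - c * c * w) / (s * s)) ((y + c * w - c * x - c * c * z) / (s * s))
      ((c * x + z - c * c * y - c * w) / (s * s)) ((c * y + w - c * c * x - c * z) / (s * s))" for x y z w
    using s by (simp add: field_simps)
  have entries: "(x + c * z - c * y - c * c * w) / (s * s) = (v - q * k + u) / 2"
    "(y + c * w - c * x - c * c * z) / (s * s) = (v - q * k - u) / 2"
    "(c * x + z - c * c * y - c * w) / (s * s) = (v + q * k - u) / 2"
    "(c * y + w - c * c * x - c * z) / (s * s) = (v + q * k + u) / 2"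
    if "x = (v - k + u) / 2" "y = (v - k - u) / 2" "z = (v + k - u) / 2" "w = (v + k + u) / 2"
    for x y z w
  proof -
    have "(x + c * z - c * y - c * c * w) - (1 - c) * (1 + c) * ((v - q * k + u) / 2)
        = (1 - c) * (q * (1 + c) - (1 - c)) * (k / 2)"
      "(y + c * w - c * x - c * c * z) - (1 - c) * (1 + c) * ((v - q * k - u) / 2)
        = (1 - c) * (q * (1 + c) - (1 - c)) * (k / 2)"
      "(c * x + z - c * c * y - c * w) - (1 - c) * (1 + c) * ((v + q * k - u) / 2)
        = - ((1 - c) * (q * (1 + c) - (1 - c)) * (k / 2))"
      "(c * y + w - c * c * x - c * z) - (1 - c) * (1 + c) * ((v + q * k + u) / 2)
        = - ((1 - c) * (q * (1 + c) - (1 - c)) * (k / 2))"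
      unfolding that by (simp_all add: field_simps)
    then have "x + c * z - c * y - c * c * w = s * s * ((v - q * k + u) / 2)"
      "y + c * w - c * x - c * c * z = s * s * ((v - q * k - u) / 2)"
      "c * x + z - c * c * y - c * w = s * s * ((v + q * k - u) / 2)"
      "c * y + w - c * c * x - c * z = s * s * ((v + q * k + u) / 2)"
      unfolding q sc by simp_all
    then show "(x + c * z - c * y - c * c * w) / (s * s) = (v - q * k + u) / 2"
      "(y + c * w - c * x - c * c * z) / (s * s) = (v - q * k - u) / 2"
      "(c * x + z - c * c * y - c * w) / (s * s) = (v + q * k - u) / 2"
      "(c * y + w - c * c * x - c * z) / (s * s) = (v + q * k + u) / 2"
      using s by simp_all
  qed
  obtain x y z w where xyzw: "x = (v - k + u) / 2" "y = (v - k - u) / 2"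
    "z = (v + k - u) / 2" "w = (v + k + u) / 2" by blast
  have M: "minus_one_fixer u v k = mat22 x y z w" by (simp only: minus_one_fixer_def xyzw)
  show ?thesis
    unfolding L M adj_mat22 prod entries[OF xyzw] c_s_def(1)[symmetric] q_def[symmetric]
    by (simp only: minus_one_fixer_def)
qed

text \<open>The hypothesis on the entries says that -1 is a fixed point. Conjugating by powers of \<open>iota gam^m\<close>
  contracts the corner entry towards 0 and leaves the rest bounded. If the corner entry were not 0,
  this would give infinitely many elements with bounded entries, against discreteness. So 1 is fixed
  as well.\<close>

lemma fixing_minus_one:
  assumes m: "p = 2 * m" and A: "psl (mat22 a b c d) \<in> carrier (Hecke p)" "a * d - b * c = 1"
    and fixed: "b - c = a - d"
  shows "a = d"
proof (rule ccontr)
  assume ad: "a \<noteq> d"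
  interpret H: group "Hecke p" by (rule group_Hecke)
  define u v k where "u = a - b" "v = (a + b + c + d) / 2" "k = (c + d - a - b) / 2"
  have M0: "mat22 a b c d = minus_one_fixer u v k"
    using fixed by (simp add: minus_one_fixer_def u_v_k_def field_simps)
  have k: "k \<noteq> 0" using ad fixed by (simp add: u_v_k_def)
  have "u * v = a * d - b * c"
  proof -
    have d: "d = a - b + c" using fixed by simp
    show ?thesis unfolding u_v_k_def d by (simp add: field_simps)
  qed
  then have u: "u \<noteq> 0" using A(2) by auto
  define q where "q = (1 - cos (pi / real p)) / (1 + cos (pi / real p))"
  have q: "0 < q" "q < 1"
  proof -
    have "cos (pi / real p) < 1"
    proof -
      have "(cos (pi / real p))\<^sup>2 < 1"
        using sin_cos_squared_add[of "pi / real p"] sin_pos by (smt (verit) zero_less_power)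
      then show ?thesis using cos_pos by (metis abs_of_pos abs_square_less_1)
    qed
    then show "0 < q" "q < 1" using cos_pos by (simp_all add: q_def field_simps)
  qed
  let ?M = "\<lambda>n. minus_one_fixer u v (q ^ n * k)"
  have car: "psl (?M n) \<in> carrier (Hecke p)" for n
  proof (induction n)
    case 0
    then show ?case using A(1) M0 by simp
  next
    case (Suc n)
    let ?L = "letter p (real m)"
    have L: "psl ?L \<in> carrier (Hecke p)" "psl (adj ?L) \<in> carrier (Hecke p)"
      using letter_carrier H.inv_closed[OF letter_carrier[of m]] Hecke_inv[OF letter_carrier[of m]] by simp_all
    have "psl (?L ** ?M n ** adj ?L) \<in> carrier (Hecke p)"
      using H.m_closed[OF H.m_closed[OF L(1) Suc] L(2)] by simp
    then show ?case using minus_one_fixer_conj[OF m, of u v "q ^ n * k"] by (simp add: q_def mult.assoc)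
  qed
  have inj: "inj (\<lambda>n. psl (?M n))"
  proof (rule linorder_injI)
    fix i j :: nat assume "i < j"
    then have "q ^ j < q ^ i" using q by (intro power_strict_decreasing) auto
    then have "q ^ i * k \<noteq> q ^ j * k" using k by simp
    then show "psl (?M i) \<noteq> psl (?M j)" using psl_minus_one_fixer_inj[OF u] by blast
  qed
  let ?B = "\<bar>u\<bar> + \<bar>v\<bar> + \<bar>k\<bar>"
  have "range (\<lambda>n. psl (?M n)) \<subseteq> {z \<in> carrier (Hecke p). \<exists>M\<in>z. entry_bounded ?B M}"
  proof clarify
    fix n
    have "q ^ n \<le> 1" using q by (simp add: power_le_one)
    then have qk: "\<bar>q ^ n * k\<bar> \<le> \<bar>k\<bar>" using q mult_right_mono[of "q ^ n" 1 "\<bar>k\<bar>"] by (simp add: abs_mult)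
    have half: "\<bar>(a + b + c) / 2\<bar> \<le> u' + v' + k'"
      if "\<bar>a\<bar> \<le> v'" "\<bar>b\<bar> \<le> k'" "\<bar>c\<bar> \<le> u'" for a b c u' v' k' :: real
    proof -
      have "\<bar>a + b + c\<bar> \<le> \<bar>a\<bar> + \<bar>b\<bar> + \<bar>c\<bar>" by linarith
      then have "\<bar>a + b + c\<bar> \<le> u' + v' + k'" using that by linarith
      then show ?thesis by simp
    qed
    note bounds = half[of v "\<bar>v\<bar>" "- (q ^ n * k)" "\<bar>k\<bar>" u "\<bar>u\<bar>"]
      half[of v "\<bar>v\<bar>" "- (q ^ n * k)" "\<bar>k\<bar>" "- u" "\<bar>u\<bar>"]
      half[of v "\<bar>v\<bar>" "q ^ n * k" "\<bar>k\<bar>" "- u" "\<bar>u\<bar>"]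
      half[of v "\<bar>v\<bar>" "q ^ n * k" "\<bar>k\<bar>" u "\<bar>u\<bar>"]
    have "entry_bounded ?B (?M n)" unfolding minus_one_fixer_def entry_bounded_mat22
      using qk bounds by simp
    then show "psl (?M n) \<in> carrier (Hecke p) \<and> (\<exists>M\<in>psl (?M n). entry_bounded ?B M)"
      using car by (auto simp: psl_def)
  qed
  then have "finite (range (\<lambda>n. psl (?M n)))" using finite_entry_bounded by (rule finite_subset)
  then show False using inj by (metis finite_imageD infinite_UNIV_nat)
qed

section \<open>Counting in a reciprocal class\<close>

text \<open>The abstract count applies to the Hecke group, with the two classes of reciprocators \<open>r\<close> and \<open>r e\<close> for
  a generator \<open>e\<close> of the centralizer.\<close>

lemma reciprocal_class_counts:
  assumes hyp: "hyperbolic g" and rec: "reciprocal (Hecke p) g"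
  obtains r r' where "r \<noteq> r'" "r \<in> reciprocators (Hecke p) g" "r' \<in> reciprocators (Hecke p) g"
    "\<And>q. q \<in> reciprocators (Hecke p) g \<Longrightarrow> conjugate (Hecke p) q r \<or> conjugate (Hecke p) q r'"
    "\<And>t. t \<in> carrier (Hecke p) \<Longrightarrow> card {x \<in> conjugacy_class (Hecke p) g. t \<in> reciprocators (Hecke p) x}
       = card (centralizer (Hecke p) t) * card {s \<in> {r, r'}. conjugate (Hecke p) s t}"
proof -
  interpret H: group "Hecke p" by (rule group_Hecke)
  have g: "g \<in> carrier (Hecke p)" using rec by (simp add: reciprocal_def)
  obtain A' where A': "g = psl A'" "det A' = 1" using carrier_Hecke_psl[OF g] .
  \<comment> \<open>The representative of positive trace, for which the expanding eigenvalue is positive.\<close>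
  obtain A where A: "g = psl A" "det A = 1" "trace A > 2"
  proof (cases "trace A' > 0")
    case True
    then show ?thesis using that[of A'] A' hyp by simp
  next
    case False
    then show ?thesis using that[of "- A'"] A' hyp by (simp add: det_neg2)
  qed
  have Ac: "psl A \<in> carrier (Hecke p)" and A2: "\<bar>trace A\<bar> > 2" using g A by simp_all
  obtain r where r: "r \<in> reciprocators (Hecke p) g" using rec by (auto simp: reciprocal_def)
  obtain e where e: "e \<in> centralizer (Hecke p) g"
    "\<And>z. z \<in> centralizer (Hecke p) g \<Longrightarrow> \<exists>y\<in>centralizer (Hecke p) g.
       z = y \<otimes>\<^bsub>Hecke p\<^esub> y \<or> z = y \<otimes>\<^bsub>Hecke p\<^esub> y \<otimes>\<^bsub>Hecke p\<^esub> e"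
    "\<And>y. y \<in> centralizer (Hecke p) g \<Longrightarrow> y \<otimes>\<^bsub>Hecke p\<^esub> y \<noteq> e"
    "\<And>y. y \<in> centralizer (Hecke p) g \<Longrightarrow> y \<otimes>\<^bsub>Hecke p\<^esub> y = \<one>\<^bsub>Hecke p\<^esub> \<Longrightarrow> y = \<one>\<^bsub>Hecke p\<^esub>"
    "\<And>y z. y \<in> centralizer (Hecke p) g \<Longrightarrow> z \<in> centralizer (Hecke p) g \<Longrightarrow>
       y \<otimes>\<^bsub>Hecke p\<^esub> z = z \<otimes>\<^bsub>Hecke p\<^esub> y"
    using hyperbolic_centralizer_generator[OF finite_entry_bounded Ac A(2,3)] unfolding A(1) by blast
  have inverts: "r \<otimes>\<^bsub>Hecke p\<^esub> z = inv\<^bsub>Hecke p\<^esub> z \<otimes>\<^bsub>Hecke p\<^esub> r"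
    if "z \<in> centralizer (Hecke p) g" for z
    using centralizer_inverted[OF Ac A(2) A2] r that by (simp add: A(1))
  let ?r' = "r \<otimes>\<^bsub>Hecke p\<^esub> e"
  have rc: "r \<in> carrier (Hecke p)" "e \<in> carrier (Hecke p)"
    using r e(1) by (auto simp: reciprocators_def centralizer_def)
  show ?thesis
  proof (rule that)
    have "e \<noteq> \<one>\<^bsub>Hecke p\<^esub>" using e(3)[of "\<one>\<^bsub>Hecke p\<^esub>"] H.centralizer_closed(3)[OF g] by auto
    then show "r \<noteq> ?r'" using rc by simp
    show "?r' \<in> reciprocators (Hecke p) g"
      using r rc e(1) H.conj_eq_iff_centralizer[of ?r' r g] g
      by (simp add: reciprocators_def H.inv_mult_cancel)
    show "card {x \<in> conjugacy_class (Hecke p) g. t \<in> reciprocators (Hecke p) x}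
       = card (centralizer (Hecke p) t) * card {s \<in> {r, ?r'}. conjugate (Hecke p) s t}"
      if "t \<in> carrier (Hecke p)" for t
      by (rule H.card_class_with_reciprocator[OF g r that inverts e(5) e(1) e(2) e(3) e(4)])
    show "conjugate (Hecke p) q r \<or> conjugate (Hecke p) q ?r'"
      if q: "q \<in> reciprocators (Hecke p) g" for q
    proof -
      obtain y s where y: "y \<in> centralizer (Hecke p) g" "s \<in> {r, ?r'}"
        "q = inv\<^bsub>Hecke p\<^esub> y \<otimes>\<^bsub>Hecke p\<^esub> s \<otimes>\<^bsub>Hecke p\<^esub> y"
        by (rule H.reciprocator_conj_cases[OF g r inverts e(5) e(1) e(2) q])
      have yc: "y \<in> carrier (Hecke p)" "s \<in> carrier (Hecke p)"
        using y rc by (auto simp: centralizer_def)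
      then have "s = y \<otimes>\<^bsub>Hecke p\<^esub> q \<otimes>\<^bsub>Hecke p\<^esub> inv\<^bsub>Hecke p\<^esub> y"
        unfolding y(3) by (simp add: H.m_assoc H.inv_mult_cancel)
      then have "conjugate (Hecke p) q s" using yc by (auto simp: conjugate_def)
      then show ?thesis using y(2) by auto
    qed
  qed (rule r)
qed

lemma reciprocator_types:
  assumes hyp: "hyperbolic g" and rec: "reciprocal (Hecke p) g"
    and q: "q \<in> reciprocators (Hecke p) g"
  shows "conjugate (Hecke p) q iota \<or> (\<exists>k. p = 2 * k \<and> conjugate (Hecke p) q (psl (rot p (real k))))"
proof -
  have g: "g \<in> carrier (Hecke p)" using rec by (simp add: reciprocal_def)
  obtain A where A: "g = psl A" "det A = 1" using carrier_Hecke_psl[OF g] .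
  have qc: "q \<in> carrier (Hecke p)" using q by (simp add: reciprocators_def)
  obtain R where R: "q = psl R" "det R = 1" using carrier_Hecke_psl[OF qc] .
  have "trace R = 0"
    using reciprocators_psl_iff[of A p R] A R g qc q hyp by simp
  then show ?thesis using involution_conjugate qc R by simp
qed

lemma reciprocal_class_members:
  assumes hyp: "hyperbolic g" and rec: "reciprocal (Hecke p) g" and x: "x \<in> conjugacy_class (Hecke p) g"
  shows "hyperbolic x" "reciprocal (Hecke p) x"
    "psl A = g \<Longrightarrow> psl B = x \<Longrightarrow> \<bar>trace A\<bar> = \<bar>trace B\<bar>"
proof -
  interpret H: group "Hecke p" by (rule group_Hecke)
  have g: "g \<in> carrier (Hecke p)" using rec by (simp add: reciprocal_def)
  obtain A' where A': "g = psl A'" "det A' = 1" using carrier_Hecke_psl[OF g] .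
  obtain h where h: "h \<in> carrier (Hecke p)"
    "x = h \<otimes>\<^bsub>Hecke p\<^esub> g \<otimes>\<^bsub>Hecke p\<^esub> inv\<^bsub>Hecke p\<^esub> h"
    using x by (auto simp: conjugacy_class_def conjugate_def)
  obtain M where M: "h = psl M" "det M = 1" using carrier_Hecke_psl[OF h(1)] .
  have x': "x = psl (M ** A' ** adj M)" using h M A' Hecke_inv[of M p] by simp
  have tr: "trace (M ** A' ** adj M) = trace A'" using trace_conj M by blast
  show "hyperbolic x" using hyp unfolding x' A'(1) by (simp add: tr)
  obtain q where q: "q \<in> reciprocators (Hecke p) g" using rec by (auto simp: reciprocal_def)
  then have "q \<in> carrier (Hecke p)" by (simp add: reciprocators_def)
  then show "reciprocal (Hecke p) x"
    using H.reciprocators_conj[OF h(1) g, of q] q h g by (auto simp: reciprocal_def)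
  show "\<bar>trace A\<bar> = \<bar>trace B\<bar>" if "psl A = g" "psl B = x"
  proof -
    have "\<bar>trace A\<bar> = \<bar>trace A'\<bar>" using that(1) unfolding A'(1) psl_eq_iff by auto
    moreover have "\<bar>trace B\<bar> = \<bar>trace A'\<bar>" using that(2) tr unfolding x' psl_eq_iff by auto
    ultimately show ?thesis by simp
  qed
qed

lemma symmetric_iff_reciprocator:
  assumes hyp: "hyperbolic x" and rec: "reciprocal (Hecke p) x"
  shows "symmetric x \<longleftrightarrow> iota \<in> reciprocators (Hecke p) x"
proof -
  have x: "x \<in> carrier (Hecke p)" using rec by (simp add: reciprocal_def)
  obtain A where A: "x = psl A" "det A = 1" using carrier_Hecke_psl[OF x] .
  obtain a b c d where A': "A = mat22 a b c d" by (rule mat22_cases)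
  have "iota \<in> reciprocators (Hecke p) x \<longleftrightarrow> b = c"
    using reciprocators_psl_iff[of A p J] A x hyp iota_carrier[of p]
    unfolding A' by (auto simp: iota_eq) (auto simp: J_def)
  moreover have "symmetric x \<longleftrightarrow> b = c"
    unfolding symmetric_def A(1) A' psl_def by (auto simp: mat22_cong transpose_def)
  ultimately show ?thesis by simp
qed

text \<open>The ratio is also 1 when \<open>b - c = a - d\<close> with \<open>a \<noteq> d\<close>; for elements of the Hecke group this case is void
  by \<open>fixing_minus_one\<close>.\<close>

lemma fixed_point_ratio_eq_1_iff:
  assumes m: "p = 2 * m" and x: "psl (mat22 a b c d) \<in> carrier (Hecke p)" "a * d - b * c = 1"
  shows "fixed_point_ratio (psl (mat22 a b c d)) = 1 \<longleftrightarrow> a = d \<and> b = c"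
  using fixing_minus_one[OF assms]
  by (auto simp: fixed_point_ratio_psl matrix_fixed_point_ratio_def one_ereal_def split: if_splits)

text \<open>Both sides amount to \<open>b - c = (a - d) cos (pi / p)\<close>; the convention of the ratio for \<open>a = d\<close> covers
  the case where both differences vanish.\<close>

lemma p_reciprocal_iff_reciprocator:
  assumes m: "p = 2 * m" and hyp: "hyperbolic x" and rec: "reciprocal (Hecke p) x"
  shows "p_reciprocal p x \<longleftrightarrow> psl (rot p (real m)) \<in> reciprocators (Hecke p) x"
proof -
  have x: "x \<in> carrier (Hecke p)" using rec by (simp add: reciprocal_def)
  obtain A where A: "x = psl A" "det A = 1" using carrier_Hecke_psl[OF x] .
  obtain a b c d where A': "A = mat22 a b c d" by (rule mat22_cases)
  let ?c = "cos (pi / real p)" and ?s = "sin (pi / real p)"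
  have "trace (rot p (real m)) = 0" by (simp add: rot_half(4)[OF m])
  moreover have "trace (rot p (real m) ** A) = (b - c - ?c * (a - d)) / ?s"
    unfolding rot_half(4)[OF m] A' using sin_pos by (simp add: field_simps)
  ultimately have "psl (rot p (real m)) \<in> reciprocators (Hecke p) x \<longleftrightarrow> b - c = ?c * (a - d)"
    using reciprocators_psl_iff[of A p "rot p (real m)"] A x hyp rot_carrier[of m] sin_pos by auto
  moreover have "fixed_point_ratio x = ereal ?c \<or> fixed_point_ratio x = 1 \<longleftrightarrow> b - c = ?c * (a - d)"
  proof (cases "a = d")
    case True
    then show ?thesis unfolding A(1) A' by (simp add: fixed_point_ratio_psl matrix_fixed_point_ratio_def)
  next
    case False
    have "fixed_point_ratio x \<noteq> 1"
      using fixed_point_ratio_eq_1_iff[OF m, of a b c d] x A False unfolding A' by auto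
    then show ?thesis using False unfolding A(1) A'
      by (simp add: fixed_point_ratio_psl matrix_fixed_point_ratio_def divide_eq_eq)
  qed
  ultimately show ?thesis using hyp rec by (simp add: p_reciprocal_def)
qed

text \<open>The matrices of this shape form a subgroup, namely the elements that fix -1 and 1.\<close>

lemma iota_gam_power_shape:
  assumes m: "p = 2 * m"
  shows "\<exists>a b. (iota \<otimes>\<^bsub>Hecke p\<^esub> (gam p [^]\<^bsub>Hecke p\<^esub> m)) [^]\<^bsub>Hecke p\<^esub> (n::int)
    = psl (mat22 a b b a) \<and> a * a - b * b = 1"
proof -
  interpret H: group "Hecke p" by (rule group_Hecke)
  let ?S = "{x \<in> carrier (Hecke p). \<exists>a b. x = psl (mat22 a b b a) \<and> a * a - b * b = 1}"
  have "subgroup ?S (Hecke p)"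
  proof (rule H.subgroupI)
    have "\<one>\<^bsub>Hecke p\<^esub> = psl (mat22 1 0 0 1)" by (simp add: Hecke_one mat22_one)
    moreover have "(1::real) * 1 - 0 * 0 = 1" by simp
    ultimately have "\<one>\<^bsub>Hecke p\<^esub> \<in> ?S" using H.one_closed by blast
    then show "?S \<noteq> {}" by blast
    show "inv\<^bsub>Hecke p\<^esub> x \<in> ?S" if xS: "x \<in> ?S" for x
    proof -
      obtain a b where ab: "x = psl (mat22 a b b a)" "a * a - b * b = 1" using xS by blast
      then have "inv\<^bsub>Hecke p\<^esub> x = psl (mat22 a (- b) (- b) a)"
        using xS Hecke_inv[of "mat22 a b b a" p] by simp
      moreover have "a * a - (- b) * (- b) = 1" using ab by simp
      ultimately show ?thesis using H.inv_closed xS by blast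
    qed
    show "x \<otimes>\<^bsub>Hecke p\<^esub> y \<in> ?S" if xy: "x \<in> ?S" "y \<in> ?S" for x y
    proof -
      obtain a b where ab: "x = psl (mat22 a b b a)" "a * a - b * b = 1" using xy by blast
      obtain c d where cd: "y = psl (mat22 c d d c)" "c * c - d * d = 1" using xy by blast
      have xy_eq: "x \<otimes>\<^bsub>Hecke p\<^esub> y = psl (mat22 (a * c + b * d) (a * d + b * c) (a * d + b * c) (a * c + b * d))"
        using ab cd by (simp add: algebra_simps)
      have "(a * c + b * d) * (a * c + b * d) - (a * d + b * c) * (a * d + b * c)
        = (a * a - b * b) * (c * c - d * d)" by (simp add: algebra_simps)
      then have det: "(a * c + b * d) * (a * c + b * d) - (a * d + b * c) * (a * d + b * c) = 1"
        using ab cd by simp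
      have "x \<otimes>\<^bsub>Hecke p\<^esub> y \<in> carrier (Hecke p)" using H.m_closed xy by blast
      then show ?thesis using xy_eq det by blast
    qed
  qed auto
  moreover have "iota \<otimes>\<^bsub>Hecke p\<^esub> (gam p [^]\<^bsub>Hecke p\<^esub> m) \<in> ?S"
  proof -
    let ?E = "iota \<otimes>\<^bsub>Hecke p\<^esub> (gam p [^]\<^bsub>Hecke p\<^esub> m)"
    have E: "?E = psl (letter p (real m))" by (simp add: gam_pow iota_eq J_rot)
    have L: "letter p (real m) = mat22 (sr p (real m)) (sr p (real m + 1)) (sr p (real m + 1)) (sr p (real m))"
      using rot_half[OF m] by (simp add: letter_def)
    then have "sr p (real m) * sr p (real m) - sr p (real m + 1) * sr p (real m + 1) = 1"
      using det_letter[of "real m"] by simp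
    then show ?thesis using E L letter_carrier[of m] by auto
  qed
  ultimately have "(iota \<otimes>\<^bsub>Hecke p\<^esub> (gam p [^]\<^bsub>Hecke p\<^esub> m)) [^]\<^bsub>Hecke p\<^esub> n \<in> ?S"
    by (rule H.subgroup_int_pow_closed)
  then show ?thesis by blast
qed

text \<open>A symmetric p-reciprocal element has both diagonal entries equal and both off-diagonal entries equal.
  Within a class the trace fixes the diagonal up to sign, and then the determinant fixes the
  off-diagonal entry up to sign. Of the two resulting elements each is the conjugate of the other by
  \<open>iota\<close>.\<close>

lemma card_symmetric_p_reciprocal:
  assumes m: "p = 2 * m" and hyp: "hyperbolic g" and rec: "reciprocal (Hecke p) g"
    and x0: "psl (mat22 a b b a) \<in> conjugacy_class (Hecke p) g" "a * a - b * b = 1"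
  shows "card {x \<in> conjugacy_class (Hecke p) g. symmetric_p_reciprocal p x} = 2"
proof -
  interpret H: group "Hecke p" by (rule group_Hecke)
  let ?C = "conjugacy_class (Hecke p) g"
  note mem = reciprocal_class_members[OF hyp rec]
  have carrier: "x \<in> carrier (Hecke p)" if "x \<in> ?C" for x
    using mem(2)[OF that] by (simp add: reciprocal_def)
  have a: "\<bar>a\<bar> > 1" using mem(1)[OF x0(1)] by simp
  have b: "b \<noteq> 0"
  proof
    assume "b = 0"
    then have "\<bar>a\<bar> * \<bar>a\<bar> = 1" using x0(2) by simp
    then show False using a by (metis less_1_mult less_irrefl)
  qed
  have "{x \<in> ?C. symmetric_p_reciprocal p x} = {psl (mat22 a b b a), psl (mat22 a (- b) (- b) a)}"
  proof (intro equalityI subsetI)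
    fix x assume "x \<in> {x \<in> ?C. symmetric_p_reciprocal p x}"
    then have x: "x \<in> ?C" "fixed_point_ratio x = 1" by (auto simp: symmetric_p_reciprocal_def)
    obtain B where B: "x = psl B" "det B = 1" using carrier_Hecke_psl[OF carrier[OF x(1)]] .
    obtain u v w z where B': "B = mat22 u v w z" by (rule mat22_cases)
    have uz: "u = z" "v = w"
      using fixed_point_ratio_eq_1_iff[OF m, of u v w z] x carrier B unfolding B' by auto
    obtain A where A: "g = psl A" using carrier_Hecke_psl rec unfolding reciprocal_def by metis
    have "\<bar>trace A\<bar> = \<bar>trace B\<bar>" "\<bar>trace A\<bar> = \<bar>trace (mat22 a b b a)\<bar>"
      using mem(3)[OF x(1)] mem(3)[OF x0(1)] A B by auto
    then have "\<bar>u\<bar> = \<bar>a\<bar>" unfolding B' uz by simp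
    then have ua: "u = a \<or> u = - a" by linarith
    then have "v * v = b * b" using B(2) x0(2) unfolding B' uz by auto
    then have "v = b \<or> v = - b" by (simp add: square_eq_iff)
    then show "x \<in> {psl (mat22 a b b a), psl (mat22 a (- b) (- b) a)}"
      using ua unfolding B(1) B' uz(1)[symmetric] uz(2)[symmetric] by (auto simp: psl_eq_iff)
  next
    fix x assume x: "x \<in> {psl (mat22 a b b a), psl (mat22 a (- b) (- b) a)}"
    have "conjugate (Hecke p) (psl (mat22 a b b a)) (psl (J ** mat22 a b b a ** adj J))"
      using conjugate_psl[of J] iota_carrier[of p] by (simp add: iota_eq)
    then have "conjugate (Hecke p) (psl (mat22 a b b a)) (psl (mat22 a (- b) (- b) a))"
      by (simp add: J_def)
    then have "psl (mat22 a (- b) (- b) a) \<in> ?C"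
      using x0(1) H.conjugate_trans rec unfolding conjugacy_class_def reciprocal_def by blast
    then have xC: "x \<in> ?C" using x x0(1) by auto
    have "fixed_point_ratio x = 1"
      using x by (auto simp: fixed_point_ratio_psl matrix_fixed_point_ratio_def)
    then show "x \<in> {x \<in> ?C. symmetric_p_reciprocal p x}"
      using xC mem by (simp add: symmetric_p_reciprocal_def)
  qed
  moreover have "psl (mat22 a b b a) \<noteq> psl (mat22 a (- b) (- b) a)"
    using a b by (auto simp: psl_eq_iff)
  ultimately show ?thesis by simp
qed

end

theorem theorem1p7:
  fixes p :: nat and C :: "(real^2^2) set set"
  assumes "3 \<le> p" and "reciprocal_class p C"
  shows "(odd p \<longrightarrow> card {x \<in> C. symmetric x} = 4) \<and>
    (\<forall>m. p = 2 * m \<longrightarrow>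
      ((\<forall>x\<in>C. \<forall>h\<in>reciprocators (Hecke p) x. conjugate (Hecke p) h iota) \<longrightarrow>
         card {x \<in> C. symmetric x} = 4) \<and>
      ((\<forall>x\<in>C. \<forall>h\<in>reciprocators (Hecke p) x.
          conjugate (Hecke p) h (gam p [^]\<^bsub>Hecke p\<^esub> m)) \<longrightarrow>
         card {x \<in> C. p_reciprocal p x} = 2 * p) \<and>
      ((\<forall>x\<in>C. (\<exists>h\<in>reciprocators (Hecke p) x. conjugate (Hecke p) h iota) \<and>
               (\<exists>h\<in>reciprocators (Hecke p) x.
                  conjugate (Hecke p) h (gam p [^]\<^bsub>Hecke p\<^esub> m))) \<longrightarrow>
         ((\<forall>n::int. n \<noteq> 0 \<longrightarrow>
             (iota \<otimes>\<^bsub>Hecke p\<^esub> (gam p [^]\<^bsub>Hecke p\<^esub> m)) [^]\<^bsub>Hecke p\<^esub> n \<notin> C) \<longrightarrow>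
            card {x \<in> C. symmetric x} = 2 \<and> card {x \<in> C. p_reciprocal p x} = p) \<and>
         ((\<exists>n::int. n \<noteq> 0 \<and>
             (iota \<otimes>\<^bsub>Hecke p\<^esub> (gam p [^]\<^bsub>Hecke p\<^esub> m)) [^]\<^bsub>Hecke p\<^esub> n \<in> C) \<longrightarrow>
            card {x \<in> C. symmetric_p_reciprocal p x} = 2 \<and>
            card {x \<in> C. p_reciprocal p x \<and> \<not> symmetric_p_reciprocal p x} = p - 2)))"
proof -
  interpret Hecke_index p by unfold_locales (rule assms(1))
  interpret H: group "Hecke p" by (rule group_Hecke)
  obtain g where g: "hyperbolic g" "reciprocal (Hecke p) g" and C: "C = conjugacy_class (Hecke p) g"
    using assms(2) by (auto simp: reciprocal_class_def)
  have gC: "g \<in> C"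
    using conjugate_refl g(2) by (simp add: C conjugacy_class_def reciprocal_def)
  note mem = reciprocal_class_members(1,2)[OF g, folded C]
  obtain r r' where rr: "r \<noteq> r'" and r: "r \<in> reciprocators (Hecke p) g" and r': "r' \<in> reciprocators (Hecke p) g"
    and conj: "\<And>q. q \<in> reciprocators (Hecke p) g \<Longrightarrow> conjugate (Hecke p) q r \<or> conjugate (Hecke p) q r'"
    and count: "\<And>t. t \<in> carrier (Hecke p) \<Longrightarrow> card {x \<in> C. t \<in> reciprocators (Hecke p) x}
       = card (centralizer (Hecke p) t) * card {s \<in> {r, r'}. conjugate (Hecke p) s t}"
    using reciprocal_class_counts[OF g] unfolding C by blast
  have rcar: "q \<in> carrier (Hecke p)" if "q \<in> reciprocators (Hecke p) g" for q
    using that by (simp add: reciprocators_def)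
  have both: "card {s \<in> {r, r'}. conjugate (Hecke p) s t} = 2"
    if "\<And>q. q \<in> reciprocators (Hecke p) g \<Longrightarrow> conjugate (Hecke p) q t" for t
  proof -
    have "{s \<in> {r, r'}. conjugate (Hecke p) s t} = {r, r'}" using that r r' by auto
    then show ?thesis using rr by simp
  qed
  have sym: "{x \<in> C. symmetric x} = {x \<in> C. iota \<in> reciprocators (Hecke p) x}"
    using symmetric_iff_reciprocator mem by blast
  have card_sym: "card {x \<in> C. symmetric x} = 2 * card {s \<in> {r, r'}. conjugate (Hecke p) s iota}"
    unfolding sym using count[OF iota_carrier] card_centralizer_iota by simp
  have odd: "card {x \<in> C. symmetric x} = 4" if "odd p"
  proof -
    have "conjugate (Hecke p) q iota" if "q \<in> reciprocators (Hecke p) g" for q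
      using reciprocator_types[OF g that] \<open>odd p\<close> by auto
    then show ?thesis using card_sym both by simp
  qed
  have even: "card {x \<in> C. symmetric x} = 4"
    if "\<forall>x\<in>C. \<forall>h\<in>reciprocators (Hecke p) x. conjugate (Hecke p) h iota"
    using card_sym both that gC by simp
  show ?thesis
  proof (intro conjI allI impI)
    fix m assume m: "p = 2 * m"
    let ?t = "gam p [^]\<^bsub>Hecke p\<^esub> m"
    have t: "?t = psl (rot p (real m))" by (rule gam_pow)
    have pr: "{x \<in> C. p_reciprocal p x} = {x \<in> C. ?t \<in> reciprocators (Hecke p) x}"
      unfolding t using p_reciprocal_iff_reciprocator[OF m] mem by blast
    have card_pr: "card {x \<in> C. p_reciprocal p x} = p * card {s \<in> {r, r'}. conjugate (Hecke p) s ?t}"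
      unfolding pr t using count[OF rot_carrier] card_centralizer_rot_half[OF m] by simp
    show "card {x \<in> C. p_reciprocal p x} = 2 * p"
      if "\<forall>x\<in>C. \<forall>h\<in>reciprocators (Hecke p) x. conjugate (Hecke p) h ?t"
      using card_pr both[of ?t] that gC by simp
    \<comment> \<open>One of the two classes of reciprocators is of either type, because no involution is of both types:
    the centralizers have the orders 2 and \<open>p\<close>.\<close>
    have mixed: "card {x \<in> C. symmetric x} = 2 \<and> card {x \<in> C. p_reciprocal p x} = p"
      if mix: "\<forall>x\<in>C. (\<exists>h\<in>reciprocators (Hecke p) x. conjugate (Hecke p) h iota) \<and>
               (\<exists>h\<in>reciprocators (Hecke p) x. conjugate (Hecke p) h ?t)"
    proof -
      have excl: "\<not> (conjugate (Hecke p) q iota \<and> conjugate (Hecke p) q ?t)"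
        if "q \<in> carrier (Hecke p)" for q
      proof
        assume "conjugate (Hecke p) q iota \<and> conjugate (Hecke p) q ?t"
        then have "card (centralizer (Hecke p) iota) = card (centralizer (Hecke p) ?t)"
          using H.card_centralizer_conjugate[OF _ that] by metis
        then show False
          using card_centralizer_iota card_centralizer_rot_half[OF m] assms(1) by (simp add: t)
      qed
      have one: "conjugate (Hecke p) r s \<or> conjugate (Hecke p) r' s"
        if h: "\<exists>h\<in>reciprocators (Hecke p) g. conjugate (Hecke p) h s" for s
      proof -
        obtain h where h: "h \<in> reciprocators (Hecke p) g" "conjugate (Hecke p) h s" using h by blast
        then show ?thesis
          using conj[OF h(1)] H.conjugate_sym[OF _ rcar[OF h(1)]] H.conjugate_trans rcar r r' by blast
      qed
      have "conjugate (Hecke p) r iota \<or> conjugate (Hecke p) r' iota"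
        "conjugate (Hecke p) r ?t \<or> conjugate (Hecke p) r' ?t"
        using one mix gC by blast+
      then have "({s \<in> {r, r'}. conjugate (Hecke p) s iota} = {r} \<and> {s \<in> {r, r'}. conjugate (Hecke p) s ?t} = {r'}) \<or>
        ({s \<in> {r, r'}. conjugate (Hecke p) s iota} = {r'} \<and> {s \<in> {r, r'}. conjugate (Hecke p) s ?t} = {r})"
        using excl[OF rcar[OF r]] excl[OF rcar[OF r']] by blast
      then show ?thesis using card_sym card_pr by auto
    qed
    then show "card {x \<in> C. symmetric x} = 2" "card {x \<in> C. p_reciprocal p x} = p"
      if "\<forall>x\<in>C. (\<exists>h\<in>reciprocators (Hecke p) x. conjugate (Hecke p) h iota) \<and>
               (\<exists>h\<in>reciprocators (Hecke p) x. conjugate (Hecke p) h ?t)" using that by auto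
    have sp: "card {x \<in> C. symmetric_p_reciprocal p x} = 2"
      if ex: "\<exists>n::int. n \<noteq> 0 \<and> (iota \<otimes>\<^bsub>Hecke p\<^esub> ?t) [^]\<^bsub>Hecke p\<^esub> n \<in> C"
    proof -
      obtain n :: int where n: "(iota \<otimes>\<^bsub>Hecke p\<^esub> ?t) [^]\<^bsub>Hecke p\<^esub> n \<in> C" using ex by blast
      obtain a b where "(iota \<otimes>\<^bsub>Hecke p\<^esub> ?t) [^]\<^bsub>Hecke p\<^esub> n = psl (mat22 a b b a)" "a * a - b * b = 1"
        using iota_gam_power_shape[OF m] by blast
      then show ?thesis using card_symmetric_p_reciprocal[OF m g] n unfolding C by simp
    qed
    then show "card {x \<in> C. symmetric_p_reciprocal p x} = 2"
      if "\<exists>n::int. n \<noteq> 0 \<and> (iota \<otimes>\<^bsub>Hecke p\<^esub> ?t) [^]\<^bsub>Hecke p\<^esub> n \<in> C" using that by blast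
    show "card {x \<in> C. p_reciprocal p x \<and> \<not> symmetric_p_reciprocal p x} = p - 2"
      if "\<forall>x\<in>C. (\<exists>h\<in>reciprocators (Hecke p) x. conjugate (Hecke p) h iota) \<and>
               (\<exists>h\<in>reciprocators (Hecke p) x. conjugate (Hecke p) h ?t)"
        "\<exists>n::int. n \<noteq> 0 \<and> (iota \<otimes>\<^bsub>Hecke p\<^esub> ?t) [^]\<^bsub>Hecke p\<^esub> n \<in> C"
    proof -
      have "{x \<in> C. p_reciprocal p x \<and> \<not> symmetric_p_reciprocal p x}
        = {x \<in> C. p_reciprocal p x} - {x \<in> C. symmetric_p_reciprocal p x}" by auto
      moreover have "{x \<in> C. symmetric_p_reciprocal p x} \<subseteq> {x \<in> C. p_reciprocal p x}"
        by (auto simp: symmetric_p_reciprocal_def p_reciprocal_def)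
      moreover have "finite {x \<in> C. symmetric_p_reciprocal p x}"
        using sp[OF that(2)] by (intro card_ge_0_finite) simp
      ultimately show ?thesis using mixed[OF that(1)] sp[OF that(2)] by (simp add: card_Diff_subset)
    qed
  qed (use odd even in auto)
qed

end
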